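(* (i) Let $\Omega\subset\mathbb C$ be an arbitrary bounded open set. Then the set of $g\in\bigcap_{p<2}\mathcal{O}L^p(\Omega)$ which are totally unbounded in $\Omega$ is dense and $G_\delta$ in $\bigcap_{p<2}\mathcal{O}L^p(\Omega)$. (ii) Let $\Omega\subset\mathbb C$ be a bounded open set such that for every $\zeta\in\partial\Omega$ the connected component $C_\zeta$ of $\mathbb C\setminus\Omega$ containing $\zeta$ satisfies $C_\zeta\setminus\{\zeta\}\ne\emptyset$. Then for each $q$ with $1<q<\infty$, the set of $g\in\bigcap_{p<q}\mathcal{O}L^p(\Omega)$ which are totally unbounded in $\Omega$ is dense and $G_\delta$ in $\bigcap_{p<q}\mathcal{O}L^p(\Omega)$. (iii) Let $\Omega\subset\mathbb C$ be a bounded open set with $C^1$ boundary and $1<q\le\infty$. Then the set $$\Big\{g\in\bigcap_{p<q}\mathcal{O}L^p(\Omega): g\text{ totally unbounded in }\Omega,\ g\notin\mathcal{O}L^q(B(\zeta,\varepsilon)\cap\Omega)\ \forall\zeta\in\partial\Omega,\ \forall\varepsilon>0\Big\}$$ is dense and $G_\delta$ in $\bigcap_{p<q}\mathcal{O}L^p(\Omega)$.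
   Context: For an open bounded set $D$ and $p\ge1$, $\mathcal{O}L^p(D)$ is the space of holomorphic $f$ on $D$ with $\int_D|f|^p\,dv<\infty$; $\mathcal{O}L^\infty(D)$ is the space of bounded holomorphic functions. For $1<q\le\infty$, $\bigcap_{p<q}\mathcal{O}L^p(\Omega)$ carries the complete metric $d(f,g)=\sum_j2^{-j}\frac{\|f-g\|_{p_j}}{1+\|f-g\|_{p_j}}$ with $1<p_1<p_2<\dots$, $p_j\to q$; convergence means $\|f_k-f\|_p\to0$ for all $p<q$. A holomorphic $f$ is totally unbounded in $\Omega$ if for every $w\in\partial\Omega$, $\delta>0$ and every connected component $E$ of $B(w,\delta)\cap\Omega$, $\sup_E|f|=\infty$. *)

theory Defs
  imports "HOL-Analysis.Analysis"
begin

definition lp_integral :: "real \<Rightarrow> complex set \<Rightarrow> (complex \<Rightarrow> complex) \<Rightarrow> ennreal" where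
  "lp_integral p D f = (\<integral>\<^sup>+ z. ennreal (cmod (f z) powr p) * indicator D z \<partial>lborel)"

definition OLp :: "ereal \<Rightarrow> complex set \<Rightarrow> (complex \<Rightarrow> complex) set" where
  "OLp q D = {f. f holomorphic_on D \<and>
     (if q = \<infinity> then bounded (f ` D) else lp_integral (real_of_ereal q) D f < \<infinity>)}"

definition lp_norm :: "real \<Rightarrow> complex set \<Rightarrow> (complex \<Rightarrow> complex) \<Rightarrow> real" where
  "lp_norm p D f = (enn2real (lp_integral p D f)) powr (1 / p)"

text \<open>The space bigcap_{p<q} OL^p(Omega). Functions are represented by their zero extension
  outside Omega, so that elements of the space correspond one-to-one to holomorphic functions
  on Omega.\<close>
definition OLbelow :: "ereal \<Rightarrow> complex set \<Rightarrow> (complex \<Rightarrow> complex) set" where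
  "OLbelow q \<Omega> = {f. f holomorphic_on \<Omega> \<and> (\<forall>z. z \<notin> \<Omega> \<longrightarrow> f z = 0) \<and>
     (\<forall>p::real. 1 \<le> p \<and> ereal p < q \<longrightarrow> f \<in> OLp (ereal p) \<Omega>)}"

text \<open>Admissible exponent sequences: 1 < p_1 < p_2 < ..., p_j \<rightarrow> q (indexed from 0 here).\<close>
definition admissible_seq :: "ereal \<Rightarrow> (nat \<Rightarrow> real) \<Rightarrow> bool" where
  "admissible_seq q p \<longleftrightarrow> 1 < p 0 \<and> (\<forall>j. p j < p (Suc j)) \<and> ((\<lambda>j. ereal (p j)) \<longlonglongrightarrow> q)"

definition OLdist :: "complex set \<Rightarrow> (nat \<Rightarrow> real) \<Rightarrow> (complex \<Rightarrow> complex) \<Rightarrow> (complex \<Rightarrow> complex) \<Rightarrow> real" where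
  "OLdist \<Omega> p f g = (\<Sum>j. (1/2) ^ Suc j * (lp_norm (p j) \<Omega> (\<lambda>z. f z - g z) /
                                          (1 + lp_norm (p j) \<Omega> (\<lambda>z. f z - g z))))"

definition ms_open :: "'a set \<Rightarrow> ('a \<Rightarrow> 'a \<Rightarrow> real) \<Rightarrow> 'a set \<Rightarrow> bool" where
  "ms_open X d U \<longleftrightarrow> U \<subseteq> X \<and> (\<forall>f\<in>U. \<exists>e>0. \<forall>g\<in>X. d f g < e \<longrightarrow> g \<in> U)"

definition ms_dense :: "'a set \<Rightarrow> ('a \<Rightarrow> 'a \<Rightarrow> real) \<Rightarrow> 'a set \<Rightarrow> bool" where
  "ms_dense X d A \<longleftrightarrow> A \<subseteq> X \<and> (\<forall>f\<in>X. \<forall>e>0. \<exists>g\<in>A. d f g < e)"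

definition ms_gdelta :: "'a set \<Rightarrow> ('a \<Rightarrow> 'a \<Rightarrow> real) \<Rightarrow> 'a set \<Rightarrow> bool" where
  "ms_gdelta X d A \<longleftrightarrow> (\<exists>U :: nat \<Rightarrow> 'a set. (\<forall>n. ms_open X d (U n)) \<and> A = (\<Inter>n. U n))"

definition totally_unbounded :: "(complex \<Rightarrow> complex) \<Rightarrow> complex set \<Rightarrow> bool" where
  "totally_unbounded f \<Omega> \<longleftrightarrow>
     (\<forall>w\<in>frontier \<Omega>. \<forall>\<delta>>0. \<forall>x\<in>ball w \<delta> \<inter> \<Omega>.
        \<not> bounded (f ` connected_component_set (ball w \<delta> \<inter> \<Omega>) x))"

definition C1_boundary :: "complex set \<Rightarrow> bool" where
  "C1_boundary \<Omega> \<longleftrightarrow>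
     (\<forall>\<zeta>\<in>frontier \<Omega>. \<exists>U \<rho> (grad :: complex \<Rightarrow> complex).
        open U \<and> \<zeta> \<in> U \<and>
        (\<forall>z\<in>U. (\<rho> has_derivative (\<lambda>h. grad z \<bullet> h)) (at z)) \<and>
        continuous_on U grad \<and> (\<forall>z\<in>U. grad z \<noteq> 0) \<and>
        \<Omega> \<inter> U = {z\<in>U. (\<rho> z :: real) < 0})"

end

theory Submission
  imports Defs "HOL-Complex_Analysis.Complex_Analysis"
begin

text \<open>The space \<open>X = OLbelow q \<Omega>\<close> is a complete metric space, since \<open>L\<^sup>p\<close> convergence of holomorphic
  functions implies locally uniform convergence. For open \<open>D \<subseteq> \<Omega>\<close> the intersection \<open>X \<inter> OLp s D\<close> is
  an F-sigma set (Fatou), and as a linear subspace it has a dense complement as soon as it is proper.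
  Total unboundedness, and non-integrability near every boundary point, each mean that \<open>g\<close> avoids
  countably many such subspaces; by Baire's theorem it is enough to find, for each of them, one
  function outside it. Near a boundary point \<open>\<zeta>\<close> these are \<open>1 / (z - \<zeta>)\<close> in (i), and a branch of
  \<open>((z - a) / (z - \<zeta>)) powr (2 / q)\<close> in (ii) and in (iii) for finite \<open>q\<close>, where \<open>a\<close> lies in the same
  component of the complement as \<open>\<zeta>\<close>. In (iii) with \<open>q = \<infinity>\<close> the principal logarithm of
  \<open>(z - a) / (z - \<zeta>)\<close> works, with \<open>a\<close> on the outer normal at \<open>\<zeta>\<close>.\<close>

section \<open>Powers of the distance to a point\<close>

lemma ennreal_suminf_ge_term:
  fixes F :: "nat \<Rightarrow> ennreal"
  shows "F n \<le> suminf F"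
  using sum_le_suminf[of F "{n}"] by simp

lemma ennreal_suminf_const_infinite:
  assumes "0 < c"
  shows "(\<Sum>n::nat. ennreal c) = \<infinity>"
proof (rule ccontr)
  assume "\<not> ?thesis"
  then have "summable (\<lambda>n::nat. c)"
    using assms by (intro summable_suminf_not_top) auto
  then show False
    using assms by (simp add: summable_const_iff)
qed

lemma nn_integral_suminf_cmult_indicator:
  fixes a :: "nat \<Rightarrow> ennreal"
  assumes "\<And>n. B n \<in> sets M"
  shows "(\<integral>\<^sup>+x. (\<Sum>n. a n * indicator (B n) x) \<partial>M) = (\<Sum>n. a n * emeasure M (B n))"
  using assms by (subst nn_integral_suminf) (auto simp: nn_integral_cmult_indicator)

lemma nn_integral_le_suminf_cover:
  fixes f :: "'a \<Rightarrow> ennreal" and a :: "nat \<Rightarrow> ennreal"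
  assumes B: "\<And>n. B n \<in> sets M"
    and cover: "\<And>x. x \<in> K \<Longrightarrow> f x \<noteq> 0 \<Longrightarrow> \<exists>n. x \<in> B n \<and> f x \<le> a n"
  shows "(\<integral>\<^sup>+x. f x * indicator K x \<partial>M) \<le> (\<Sum>n. a n * emeasure M (B n))"
proof -
  have "f x * indicator K x \<le> (\<Sum>n. a n * indicator (B n) x)" for x
  proof (cases "x \<in> K \<and> f x \<noteq> 0")
    case True
    then obtain n where "x \<in> B n" "f x \<le> a n"
      using cover by blast
    then have "f x * indicator K x \<le> a n * indicator (B n) x"
      using True by simp
    also have "\<dots> \<le> (\<Sum>n. a n * indicator (B n) x)"
      by (rule ennreal_suminf_ge_term)
    finally show ?thesis .
  qed auto
  then show ?thesis
    unfolding nn_integral_suminf_cmult_indicator[OF B, symmetric] by (rule nn_integral_mono)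
qed

lemma suminf_disjoint_le_nn_integral:
  fixes f :: "'a \<Rightarrow> ennreal" and a :: "nat \<Rightarrow> ennreal"
  assumes B: "\<And>n. B n \<in> sets M" "disjoint_family B" "\<And>n. B n \<subseteq> K"
    and le: "\<And>n x. x \<in> B n \<Longrightarrow> a n \<le> f x"
  shows "(\<Sum>n. a n * emeasure M (B n)) \<le> (\<integral>\<^sup>+x. f x * indicator K x \<partial>M)"
proof -
  have "(\<Sum>n. a n * indicator (B n) x) \<le> f x * indicator K x" for x
  proof (cases "\<exists>n. x \<in> B n")
    case True
    then obtain n where "x \<in> B n" by blast
    then show ?thesis
      using suminf_cmult_indicator[OF B(2)] le B(3)[of n] by auto
  qed auto
  then show ?thesis
    unfolding nn_integral_suminf_cmult_indicator[OF B(1), symmetric] by (rule nn_integral_mono)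
qed

lemma dyadic_shell:
  fixes x R :: real
  assumes "0 < x" "x \<le> R"
  obtains n :: nat where "R / 2 ^ Suc n < x" "x \<le> R / 2 ^ n"
proof
  define n where "n = nat \<lfloor>log 2 (R / x)\<rfloor>"
  have "0 \<le> log 2 (R / x)"
    using assms by simp
  then have "real n \<le> log 2 (R / x)" "log 2 (R / x) < real (Suc n)"
    unfolding n_def by linarith+
  then have "2 powr real n \<le> R / x" "R / x < 2 powr real (Suc n)"
    using assms by (auto simp: le_log_iff log_less_iff)
  then have "2 ^ n \<le> R / x" "R / x < 2 ^ Suc n"
    by (simp_all only: powr_realpow zero_less_numeral)
  then show "R / 2 ^ Suc n < x" "x \<le> R / 2 ^ n"
    using assms by (simp_all add: field_simps)
qed

lemma dyadic_shell_term:
  fixes R \<beta> :: real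
  assumes "0 < R"
  shows "(R / 2 ^ Suc n) powr - \<beta> * (R / 2 ^ n) ^ d
    = (R / 2) powr - \<beta> * R ^ d * (2 powr (\<beta> - real d)) ^ n"
proof -
  have "R / 2 ^ Suc n = (R / 2) / 2 powr real n"
    by (simp add: powr_realpow)
  then have "(R / 2 ^ Suc n) powr - \<beta> = (R / 2) powr - \<beta> / 2 powr - (real n * \<beta>)"
    by (simp only: powr_divide powr_powr mult_minus_right)
  moreover have "(R / 2 ^ n) ^ d = R ^ d / 2 powr (real d * real n)"
    by (simp add: power_divide powr_realpow[symmetric] powr_power powr_powr mult.commute)
  moreover have "(2 powr (\<beta> - real d)) ^ n = 2 powr (real n * \<beta>) / 2 powr (real d * real n)"
    by (simp add: powr_diff power_divide powr_power mult.commute)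
  ultimately show ?thesis
    by (simp add: powr_minus_divide)
qed

lemma suminf_dyadic_shell_terms_finite:
  fixes R \<beta> :: real
  assumes R: "0 < R" and \<beta>: "\<beta> < real d" and V: "0 \<le> V"
  shows "(\<Sum>n. ennreal (V * ((R / 2 ^ Suc n) powr - \<beta> * (R / 2 ^ n) ^ d))) < \<infinity>"
proof -
  have "2 powr (\<beta> - real d) < (2::real) powr 0"
    using \<beta> by (intro powr_less_mono) auto
  then have "summable (\<lambda>n. V * ((R / 2 ^ Suc n) powr - \<beta> * (R / 2 ^ n) ^ d))"
    unfolding dyadic_shell_term[OF R] by (intro summable_mult summable_geometric) auto
  then show ?thesis
    using R V by (subst suminf_ennreal2) auto
qed

lemma nn_integral_dist_powr_bounded_finite:
  fixes c :: "'a::euclidean_space" and \<beta> :: real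
  assumes D: "bounded D" and \<beta>: "0 \<le> \<beta>" "\<beta> < DIM('a)"
  shows "(\<integral>\<^sup>+x. ennreal (norm (x - c) powr - \<beta>) * indicator D x \<partial>lborel) < \<infinity>"
proof -
  obtain R where R: "0 < R" "D \<subseteq> ball c R"
    using D bounded_subset_ballD by blast
  define V where "V = unit_ball_vol (real DIM('a))"
  define a where "a n = (R / 2 ^ Suc n) powr - \<beta>" for n :: nat
  have "\<exists>n. x \<in> cball c (R / 2 ^ n) \<and> ennreal (norm (x - c) powr - \<beta>) \<le> ennreal (a n)"
    if x: "x \<in> D" "x \<noteq> c" for x
  proof -
    have "0 < norm (x - c)" "norm (x - c) \<le> R"
      using R x by (auto simp: dist_norm norm_minus_commute less_imp_le subset_iff)
    then obtain n where n: "R / 2 ^ Suc n < norm (x - c)" "norm (x - c) \<le> R / 2 ^ n"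
      by (rule dyadic_shell)
    then have "norm (x - c) powr - \<beta> \<le> a n"
      unfolding a_def using R \<beta> by (intro powr_mono2') auto
    with n(2) show ?thesis
      by (auto simp: dist_norm norm_minus_commute ennreal_leI)
  qed
  then have "(\<integral>\<^sup>+x. ennreal (norm (x - c) powr - \<beta>) * indicator D x \<partial>lborel)
      \<le> (\<Sum>n. ennreal (a n) * emeasure lborel (cball c (R / 2 ^ n)))"
    by (intro nn_integral_le_suminf_cover) auto
  also have "\<dots> = (\<Sum>n. ennreal (V * (a n * (R / 2 ^ n) ^ DIM('a))))"
    using R by (auto simp: emeasure_cball V_def a_def mult.left_commute simp flip: ennreal_mult')
  also have "\<dots> < \<infinity>"
    unfolding a_def using R \<beta> by (intro suminf_dyadic_shell_terms_finite) (auto simp: V_def)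
  finally show ?thesis .
qed

definition truncated_cone :: "'a::real_normed_vector \<Rightarrow> 'a \<Rightarrow> real \<Rightarrow> 'a set" where
  "truncated_cone c u r = (\<Union>s\<in>{0<..<r}. ball (c + s *\<^sub>R u) (s / 4))"

lemma open_truncated_cone: "open (truncated_cone c u r)"
  by (auto simp: truncated_cone_def)

lemma truncated_cone_mono: "r \<le> r' \<Longrightarrow> truncated_cone c u r \<subseteq> truncated_cone c u r'"
  unfolding truncated_cone_def by (intro UN_mono) auto

lemma cone_ball_norm_bounds:
  fixes c :: "'a::real_normed_vector"
  assumes "norm u = 1" "x \<in> ball (c + s *\<^sub>R u) (s / 4)"
  shows "3/4 * s < norm (x - c)" "norm (x - c) < 5/4 * s"
proof -
  have "norm ((x - c) - s *\<^sub>R u) < s / 4" "norm (s *\<^sub>R u) = \<bar>s\<bar>"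
    using assms by (simp_all add: dist_norm norm_minus_commute algebra_simps)
  then show "3/4 * s < norm (x - c)" "norm (x - c) < 5/4 * s"
    using norm_triangle_ineq2[of "x - c" "s *\<^sub>R u"] norm_triangle_ineq3[of "x - c" "s *\<^sub>R u"]
    by linarith+
qed

lemma truncated_cone_subset_ball:
  assumes "norm u = 1"
  shows "truncated_cone c u r \<subseteq> ball c (2 * r)"
  using cone_ball_norm_bounds(2)[OF assms]
  by (fastforce simp: truncated_cone_def dist_norm norm_minus_commute)

lemma disjoint_family_cone_balls:
  fixes c :: "'a::real_normed_vector" and s :: "nat \<Rightarrow> real"
  assumes u: "norm u = 1" and s: "\<And>n. 0 < s n" "\<And>m n. m < n \<Longrightarrow> s n \<le> s m / 2"
  shows "disjoint_family (\<lambda>n. ball (c + s n *\<^sub>R u) (s n / 4))"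
proof -
  have "ball (c + s m *\<^sub>R u) (s m / 4) \<inter> ball (c + s n *\<^sub>R u) (s n / 4) = {}" if "m < n" for m n
  proof -
    have "5/4 * s n < 3/4 * s m"
      using s(1)[of n] s(2)[OF that] by simp
    then show ?thesis
      using cone_ball_norm_bounds[OF u] by fastforce
  qed
  then show ?thesis
    unfolding disjoint_family_on_def by (metis Int_commute linorder_neqE_nat)
qed

lemma nn_integral_dist_powr_truncated_cone_infinite:
  fixes c :: "'a::euclidean_space"
  assumes u: "norm u = 1" and r: "0 < r"
  shows "(\<integral>\<^sup>+x. ennreal (norm (x - c) powr - real DIM('a)) * indicator (truncated_cone c u r) x \<partial>lborel) = \<infinity>"
proof -
  define s where "s n = r / 2 ^ Suc n" for n :: nat
  have s: "0 < s n" "s n < r" for n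
    using r one_less_power[of "2::real" "Suc n"] by (auto simp: s_def field_simps)
  define B where "B n = ball (c + s n *\<^sub>R u) (s n / 4)" for n
  have "disjoint_family B"
  proof -
    have "s n \<le> s m / 2" if "m < n" for m n
      using power_increasing[of "Suc m" n "2::real"] that r by (simp add: s_def field_simps)
    then show ?thesis
      unfolding B_def using u s by (intro disjoint_family_cone_balls)
  qed
  have "\<infinity> = (\<Sum>n::nat. ennreal (unit_ball_vol (real DIM('a)) / 5 ^ DIM('a)))"
    by (rule ennreal_suminf_const_infinite[symmetric]) simp
  also have "\<dots> = (\<Sum>n. ennreal ((5/4 * s n) powr - real DIM('a)) * emeasure lborel (B n))"
  proof (intro suminf_cong)
    fix n
    have "(5/4 * s n) powr - real DIM('a) * (unit_ball_vol (real DIM('a)) * (s n / 4) ^ DIM('a))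
        = unit_ball_vol (real DIM('a)) / 5 ^ DIM('a)"
      using s[of n] by (simp add: powr_minus powr_realpow power_divide power_mult_distrib field_simps)
    then show "ennreal (unit_ball_vol (real DIM('a)) / 5 ^ DIM('a))
        = ennreal ((5/4 * s n) powr - real DIM('a)) * emeasure lborel (B n)"
      using s[of n] by (simp add: B_def emeasure_ball flip: ennreal_mult')
  qed
  also have "\<dots> \<le> (\<integral>\<^sup>+x. ennreal (norm (x - c) powr - real DIM('a)) * indicator (truncated_cone c u r) x \<partial>lborel)"
  proof (rule suminf_disjoint_le_nn_integral[OF _ \<open>disjoint_family B\<close>])
    show "B n \<in> sets lborel" for n
      by (simp add: B_def)
    show "B n \<subseteq> truncated_cone c u r" for n
      using s[of n] by (force simp: B_def truncated_cone_def)
    show "ennreal ((5/4 * s n) powr - real DIM('a)) \<le> ennreal (norm (x - c) powr - real DIM('a))"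
      if x: "x \<in> B n" for n x
      using cone_ball_norm_bounds[OF u x[unfolded B_def]] s[of n]
      by (intro ennreal_leI powr_mono2') auto
  qed
  finally show ?thesis
    by (simp add: top_unique)
qed

section \<open>The spaces of holomorphic functions with integrable powers\<close>

lemma OLp_ereal_iff: "f \<in> OLp (ereal p) D \<longleftrightarrow> f holomorphic_on D \<and> lp_integral p D f < top"
  by (simp add: OLp_def)

lemma OLp_PInf_iff: "f \<in> OLp \<infinity> D \<longleftrightarrow> f holomorphic_on D \<and> bounded (f ` D)"
  by (simp add: OLp_def)

lemma lp_integral_mono:
  assumes "D \<subseteq> E" shows "lp_integral p D f \<le> lp_integral p E f"
  unfolding lp_integral_def using assms by (intro nn_integral_mono) (auto split: split_indicator)

lemma OLp_antimono:
  assumes "D \<subseteq> E" shows "OLp q E \<subseteq> OLp q D"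
  using lp_integral_mono[OF assms] holomorphic_on_subset[OF _ assms] bounded_subset[OF _ image_mono[OF assms]]
  by (auto simp: OLp_def intro: le_less_trans)

lemma borel_measurable_holomorphic_on:
  assumes "f holomorphic_on D"
  shows "f \<in> borel_measurable (restrict_space lborel D)"
  using borel_measurable_continuous_on_restrict[OF holomorphic_on_imp_continuous_on[OF assms]]
    measurable_cong_sets[OF sets_restrict_space_cong[OF sets_lborel] refl] by blast

lemma borel_measurable_norm_indicator:
  assumes "open D" "f holomorphic_on D"
  shows "(\<lambda>z. ennreal (cmod (f z)) * indicator D z) \<in> borel_measurable borel"
proof -
  have "(\<lambda>z. ennreal (cmod (f z))) \<in> borel_measurable (restrict_space lborel D)"
    using borel_measurable_holomorphic_on[OF assms(2)] by measurable
  then show ?thesis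
    using assms(1) by (subst (asm) borel_measurable_restrict_space_iff_ennreal) auto
qed

lemma lp_integral_eq_restrict_space:
  assumes "D \<in> sets borel"
  shows "lp_integral p D f = (\<integral>\<^sup>+z. ennreal (cmod (f z) powr p) \<partial>restrict_space lborel D)"
  unfolding lp_integral_def using assms by (subst nn_integral_restrict_space) auto

lemma lp_integral_cmult:
  assumes "D \<in> sets borel" "f \<in> borel_measurable (restrict_space lborel D)"
  shows "lp_integral p D (\<lambda>z. c * f z) = ennreal (cmod c powr p) * lp_integral p D f"
  using assms by (simp add: lp_integral_eq_restrict_space norm_mult powr_mult ennreal_mult nn_integral_cmult)

lemma lp_integral_le_lp_integral_add_emeasure:
  assumes D: "D \<in> sets borel" and f: "f \<in> borel_measurable (restrict_space lborel D)" and rs: "0 \<le> r" "r \<le> s"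
  shows "lp_integral r D f \<le> emeasure lborel D + lp_integral s D f"
proof -
  have "ennreal (cmod (f z) powr r) \<le> 1 + ennreal (cmod (f z) powr s)" for z
  proof -
    have "cmod (f z) powr r \<le> 1 + cmod (f z) powr s"
    proof (cases "cmod (f z) \<le> 1")
      case True
      then have "cmod (f z) powr r \<le> 1 powr r"
        using rs by (intro powr_mono2) auto
      then show ?thesis by (simp add: add_increasing2)
    next
      case False
      then show ?thesis
        using rs by (simp add: add_increasing powr_mono)
    qed
    then have "ennreal (cmod (f z) powr r) \<le> ennreal (1 + cmod (f z) powr s)"
      by (rule ennreal_leI)
    then show ?thesis by simp
  qed
  then have "lp_integral r D f
      \<le> (\<integral>\<^sup>+z. 1 + ennreal (cmod (f z) powr s) \<partial>restrict_space lborel D)"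
    unfolding lp_integral_eq_restrict_space[OF D] by (intro nn_integral_mono)
  also have "\<dots> = emeasure lborel D + lp_integral s D f"
    using D f by (subst nn_integral_add)
      (auto simp: lp_integral_eq_restrict_space emeasure_restrict_space space_restrict_space)
  finally show ?thesis .
qed

lemma lp_integral_Fatou:
  fixes g :: "nat \<Rightarrow> complex \<Rightarrow> complex"
  assumes D: "D \<in> sets borel" and g: "\<And>k. g k \<in> borel_measurable (restrict_space lborel D)" and p: "0 < p"
    and lim: "\<And>z. z \<in> D \<Longrightarrow> (\<lambda>k. g k z) \<longlonglongrightarrow> f z"
    and bound: "\<forall>\<^sub>F k in sequentially. lp_integral p D (g k) \<le> C"
  shows "lp_integral p D f \<le> C"
proof -
  let ?M = "restrict_space lborel D"
  have "lp_integral p D f = (\<integral>\<^sup>+z. liminf (\<lambda>k. ennreal (cmod (g k z) powr p)) \<partial>?M)"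
    unfolding lp_integral_eq_restrict_space[OF D]
  proof (intro nn_integral_cong)
    fix z assume "z \<in> space ?M"
    then have "(\<lambda>k. ennreal (cmod (g k z) powr p)) \<longlonglongrightarrow> ennreal (cmod (f z) powr p)"
      using p by (intro tendsto_ennrealI tendsto_powr2 tendsto_norm tendsto_const lim)
        (auto simp: space_restrict_space)
    then show "ennreal (cmod (f z) powr p) = liminf (\<lambda>k. ennreal (cmod (g k z) powr p))"
      by (rule lim_imp_Liminf[OF sequentially_bot, symmetric])
  qed
  also have "\<dots> \<le> liminf (\<lambda>k. lp_integral p D (g k))"
    unfolding lp_integral_eq_restrict_space[OF D]
    using g by (intro nn_integral_liminf) auto
  also have "\<dots> \<le> C"
    using bound Liminf_mono[of "\<lambda>k. lp_integral p D (g k)" "\<lambda>_. C" sequentially]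
    by (simp add: Liminf_const)
  finally show ?thesis .
qed

lemma convex_on_powr_nonneg:
  assumes p: "1 \<le> p"
  shows "convex_on {0..} (\<lambda>x::real. x powr p)"
proof (rule convex_onI)
  fix s x y :: real
  assume s: "0 < s" "s < 1" and xy: "x \<in> {0..}" "y \<in> {0..}"
  have le_self: "t powr p \<le> t" if "0 \<le> t" "t \<le> 1" for t :: real
    using powr_mono'[of 1 p t] that p by auto
  consider (left_zero) "x = 0" | (right_zero) "y = 0" | (positive) "0 < x" "0 < y"
    using xy by fastforce
  then show "((1 - s) *\<^sub>R x + s *\<^sub>R y) powr p \<le> (1 - s) * x powr p + s * y powr p"
  proof cases
    case left_zero
    then show ?thesis
      using le_self[of s] s xy p by (simp add: powr_mult mult_right_mono)
  next
    case right_zero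
    then show ?thesis
      using le_self[of "1 - s"] s xy p by (simp add: powr_mult mult_right_mono)
  next
    case positive
    then show ?thesis
      using convex_onD[OF powr_convex[OF p], of s x y] s by simp
  qed
qed simp

lemma lp_integral_convex_combination_le:
  assumes D: "D \<in> sets borel"
    and f: "f \<in> borel_measurable (restrict_space lborel D)"
    and g: "g \<in> borel_measurable (restrict_space lborel D)"
    and p: "1 \<le> p" and s: "0 \<le> s" "s \<le> 1"
  shows "lp_integral p D (\<lambda>z. of_real (1 - s) * f z + of_real s * g z)
    \<le> ennreal (1 - s) * lp_integral p D f + ennreal s * lp_integral p D g"
proof -
  let ?M = "restrict_space lborel D"
  note [measurable] = f g
  have "ennreal (cmod (of_real (1 - s) * f z + of_real s * g z) powr p)
      \<le> ennreal (1 - s) * ennreal (cmod (f z) powr p) + ennreal s * ennreal (cmod (g z) powr p)" for z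
  proof -
    have "cmod (of_real (1 - s) * f z + of_real s * g z) \<le> (1 - s) * cmod (f z) + s * cmod (g z)"
      using s norm_triangle_ineq[of "of_real (1 - s) * f z" "of_real s * g z"]
      by (simp add: norm_mult del: of_real_diff)
    then have "cmod (of_real (1 - s) * f z + of_real s * g z) powr p
        \<le> ((1 - s) * cmod (f z) + s * cmod (g z)) powr p"
      using p by (intro powr_mono2) auto
    also have "\<dots> \<le> (1 - s) * cmod (f z) powr p + s * cmod (g z) powr p"
      using convex_onD[OF convex_on_powr_nonneg[OF p], of s "cmod (f z)" "cmod (g z)"] s by simp
    finally show ?thesis
      using s by (simp add: ennreal_leI flip: ennreal_mult ennreal_plus)
  qed
  then have "lp_integral p D (\<lambda>z. of_real (1 - s) * f z + of_real s * g z)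
      \<le> (\<integral>\<^sup>+z. ennreal (1 - s) * ennreal (cmod (f z) powr p) + ennreal s * ennreal (cmod (g z) powr p) \<partial>?M)"
    unfolding lp_integral_eq_restrict_space[OF D] by (intro nn_integral_mono)
  also have "\<dots> = ennreal (1 - s) * lp_integral p D f + ennreal s * lp_integral p D g"
    by (simp add: lp_integral_eq_restrict_space[OF D] nn_integral_add nn_integral_cmult)
  finally show ?thesis .
qed

lemma OLp_lincomb:
  assumes D: "open D" and q: "1 \<le> q" and f: "f \<in> OLp q D" and g: "g \<in> OLp q D"
  shows "(\<lambda>z. a * f z + b * g z) \<in> OLp q D"
proof (cases q)
  case (real p)
  have hol: "f holomorphic_on D" "g holomorphic_on D"
    using f g by (auto simp: real OLp_ereal_iff)
  have "lp_integral p D (\<lambda>z. of_real (1 - 1/2) * ((2 * a) * f z) + of_real (1/2) * ((2 * b) * g z))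
      \<le> ennreal (1 - 1/2) * lp_integral p D (\<lambda>z. (2 * a) * f z) + ennreal (1/2) * lp_integral p D (\<lambda>z. (2 * b) * g z)"
    using D hol q
    by (intro lp_integral_convex_combination_le borel_measurable_holomorphic_on holomorphic_intros)
      (auto simp: real)
  also have "\<dots> < top"
    using D f g ennreal_less_top[of "1/2"]
    by (auto simp: real OLp_ereal_iff ennreal_mult_less_top lp_integral_cmult borel_measurable_holomorphic_on)
  finally show ?thesis
    using hol by (auto simp: real OLp_ereal_iff intro!: holomorphic_intros)
next
  case PInf
  then obtain A B where "\<forall>z\<in>D. cmod (f z) \<le> A" "\<forall>z\<in>D. cmod (g z) \<le> B"
    using f g by (auto simp: OLp_PInf_iff bounded_iff)
  then have "cmod (a * f z + b * g z) \<le> cmod a * A + cmod b * B" if "z \<in> D" for z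
    using that by (intro norm_triangle_mono) (auto simp: norm_mult mult_left_mono)
  then show ?thesis
    using f g by (auto simp: PInf OLp_PInf_iff bounded_iff intro!: holomorphic_intros)
qed (use q in auto)

lemma lp_norm_nonneg [simp]: "0 \<le> lp_norm p D f"
  by (simp add: lp_norm_def)

lemma lp_integral_eq_lp_norm_powr:
  assumes "f \<in> OLp (ereal p) D" "0 < p"
  shows "lp_integral p D f = ennreal (lp_norm p D f powr p)"
  using assms by (simp add: lp_norm_def powr_powr OLp_ereal_iff)

lemma lp_integral_le_iff_lp_norm_le:
  assumes "f \<in> OLp (ereal p) D" "0 < p" "0 \<le> A"
  shows "lp_integral p D f \<le> ennreal (A powr p) \<longleftrightarrow> lp_norm p D f \<le> A"
proof -
  have "lp_norm p D f powr p \<le> A powr p \<longleftrightarrow> lp_norm p D f \<le> A"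
    using assms(2,3) powr_mono2[of p "lp_norm p D f" A] powr_less_mono2[of p A "lp_norm p D f"]
    by fastforce
  then show ?thesis
    using assms by (simp add: lp_integral_eq_lp_norm_powr)
qed

lemma lp_norm_cmult:
  assumes "D \<in> sets borel" "f \<in> borel_measurable (restrict_space lborel D)" "0 < p"
  shows "lp_norm p D (\<lambda>z. c * f z) = cmod c * lp_norm p D f"
  using assms by (simp add: lp_norm_def lp_integral_cmult enn2real_mult powr_mult powr_powr)

lemma lp_integral_normalized_le_1:
  assumes D: "open D" and p: "1 \<le> p" and f: "f \<in> OLp (ereal p) D"
    and A: "0 < A" "lp_norm p D f \<le> A"
  shows "lp_integral p D (\<lambda>z. of_real (inverse A) * f z) \<le> 1"
proof -
  have "(\<lambda>z. of_real (inverse A) * f z) \<in> OLp (ereal p) D"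
    using OLp_lincomb[OF D _ f f, of "of_real (inverse A)" 0] p by simp
  moreover have "lp_norm p D (\<lambda>z. of_real (inverse A) * f z) \<le> 1"
    using D p f A by (subst lp_norm_cmult) (auto simp: OLp_ereal_iff borel_measurable_holomorphic_on norm_divide divide_simps)
  ultimately show ?thesis
    using lp_integral_le_iff_lp_norm_le[of _ p D 1] p by auto
qed

text \<open>The unit ball is convex, and \<open>f + g\<close> is \<open>A + B\<close> times a convex combination of \<open>f / A\<close> and \<open>g / B\<close>.\<close>
lemma lp_norm_add_le_if_lp_norm_le:
  assumes D: "open D" and p: "1 \<le> p" and f: "f \<in> OLp (ereal p) D" and g: "g \<in> OLp (ereal p) D"
    and A: "0 < A" "lp_norm p D f \<le> A" and B: "0 < B" "lp_norm p D g \<le> B"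
  shows "lp_norm p D (\<lambda>z. f z + g z) \<le> A + B"
proof -
  have hol: "f holomorphic_on D" "g holomorphic_on D"
    using f g by (auto simp: OLp_ereal_iff)
  define s where "s = B / (A + B)"
  have s: "0 \<le> s" "s \<le> 1" "1 - s = A / (A + B)"
    using A B by (auto simp: s_def field_simps)
  define h where "h z = of_real (1 - s) * (of_real (inverse A) * f z)
    + of_real s * (of_real (inverse B) * g z)" for z
  have h: "h \<in> OLp (ereal p) D"
    unfolding h_def using D p f g
    by (simp only: mult.assoc[symmetric]) (intro OLp_lincomb, auto)
  have "lp_integral p D h \<le> ennreal (1 - s) * lp_integral p D (\<lambda>z. of_real (inverse A) * f z)
      + ennreal s * lp_integral p D (\<lambda>z. of_real (inverse B) * g z)"
    unfolding h_def using D p s hol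
    by (intro lp_integral_convex_combination_le borel_measurable_holomorphic_on holomorphic_intros) auto
  also have "\<dots> \<le> ennreal (1 - s) * 1 + ennreal s * 1"
    using D p f g A B by (intro add_mono mult_left_mono lp_integral_normalized_le_1) auto
  also have "\<dots> = ennreal (1 powr p)"
    using s by (simp flip: ennreal_plus)
  finally have "lp_norm p D h \<le> 1"
    using h p by (simp only: lp_integral_le_iff_lp_norm_le)
  moreover have "(A + B) * (1 - s) * inverse A = 1" "(A + B) * s * inverse B = 1"
    using A B unfolding s(3) by (simp_all add: s_def)
  then have "complex_of_real ((A + B) * (1 - s) * inverse A) = 1"
      "complex_of_real ((A + B) * s * inverse B) = 1"
    by (simp_all only: of_real_1)
  then have "of_real (A + B) * h z = f z + g z" for z
    by (simp only: h_def of_real_mult distrib_left mult.assoc[symmetric] mult_1_left)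
  then have "(\<lambda>z. f z + g z) = (\<lambda>z. of_real (A + B) * h z)"
    by simp
  ultimately show ?thesis
    using D p h A B
    by (simp add: lp_norm_cmult OLp_ereal_iff borel_measurable_holomorphic_on del: of_real_add)
qed

lemma lp_norm_triangle:
  assumes "open D" "1 \<le> p" "f \<in> OLp (ereal p) D" "g \<in> OLp (ereal p) D"
  shows "lp_norm p D (\<lambda>z. f z + g z) \<le> lp_norm p D f + lp_norm p D g"
proof (rule field_le_epsilon)
  fix e :: real assume "0 < e"
  then have "lp_norm p D (\<lambda>z. f z + g z) \<le> (lp_norm p D f + e / 2) + (lp_norm p D g + e / 2)"
    using assms by (intro lp_norm_add_le_if_lp_norm_le) (auto simp: add_nonneg_pos)
  then show "lp_norm p D (\<lambda>z. f z + g z) \<le> lp_norm p D f + lp_norm p D g + e"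
    by simp
qed

section \<open>Point evaluation\<close>

lemma has_integral_Cauchy_circle:
  assumes f: "f holomorphic_on cball a r" and z: "dist a z < r"
  shows "((\<lambda>t. f (circlepath a r t) * ((circlepath a r t - a) / (circlepath a r t - z)))
    has_integral f z) {0..1}"
proof -
  define \<gamma> where "\<gamma> = circlepath a r"
  define c where "c = 2 * of_real pi * \<i>"
  have "((\<lambda>u. f u / (u - z)) has_contour_integral (c * f z)) \<gamma>"
    unfolding c_def \<gamma>_def
    using f z by (intro Cauchy_integral_circlepath_simple) (auto simp: dist_norm norm_minus_commute)
  then have integral: "((\<lambda>t. inverse c * (f (\<gamma> t) / (\<gamma> t - z) * vector_derivative \<gamma> (at t within {0..1})))
      has_integral inverse c * (c * f z)) {0..1}"
    unfolding has_contour_integral_def by (rule has_integral_mult_right)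
  have c: "c \<noteq> 0"
    by (simp add: c_def)
  have derivative: "vector_derivative \<gamma> (at t within {0..1}) = c * (\<gamma> t - a)" if "t \<in> {0..1}" for t
  proof -
    have "\<gamma> t - a = r * exp (2 * of_real pi * \<i> * t)"
      by (simp add: \<gamma>_def circlepath)
    then show ?thesis
      using that by (simp add: \<gamma>_def c_def vector_derivative_circlepath01)
  qed
  have "((\<lambda>t. f (\<gamma> t) * ((\<gamma> t - a) / (\<gamma> t - z))) has_integral inverse c * (c * f z)) {0..1}"
    using integral by (rule has_integral_eq[rotated]) (simp add: derivative c)
  moreover have "inverse c * (c * f z) = f z"
    using c by (simp flip: mult.assoc)
  ultimately show ?thesis
    by (simp add: \<gamma>_def)
qed

lemma norm_circlepath_minus_center: "0 \<le> r \<Longrightarrow> cmod (circlepath a r t - a) = r"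
  by (simp add: circlepath norm_mult)

lemma norm_circlepath_minus_ge:
  assumes "0 \<le> r" "dist a z \<le> r / 2"
  shows "r / 2 \<le> cmod (circlepath a r t - z)"
  using norm_circlepath_minus_center[OF assms(1), of a t] assms(2) norm_triangle_ineq2[of "circlepath a r t - a" "z - a"]
  by (simp add: dist_norm norm_minus_commute)

lemma norm_le_circle_mean_off_center:
  assumes f: "f holomorphic_on cball a r" and z: "dist a z \<le> r / 2" and r: "0 < r"
  shows "ennreal (cmod (f z)) \<le> (\<integral>\<^sup>+t. ennreal (2 * cmod (f (circlepath a r t))) * indicator {0..1} t \<partial>lborel)"
proof -
  define g where "g t = f (circlepath a r t) * ((circlepath a r t - a) / (circlepath a r t - z))" for t
  have on_circle: "cmod (circlepath a r t - a) = r" for t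
    using r by (simp add: norm_circlepath_minus_center)
  have far: "r / 2 \<le> cmod (circlepath a r t - z)" for t
    using r z by (intro norm_circlepath_minus_ge) auto
  have circle: "continuous_on {0..1} (circlepath a r)"
    using path_circlepath by (simp add: path_def)
  then have "continuous_on {0..1} (\<lambda>t. f (circlepath a r t))"
    using on_circle
    by (intro continuous_on_compose2[OF holomorphic_on_imp_continuous_on[OF f]])
      (auto simp: dist_norm norm_minus_commute)
  moreover have "circlepath a r t - z \<noteq> 0" for t
    using far[of t] r by auto
  ultimately have "continuous_on {0..1} g"
    unfolding g_def using circle by (intro continuous_intros) auto
  then have g: "set_integrable lborel {0..1} g"
    by (rule borel_integrable_atLeastAtMost')
  have "(g has_integral f z) {0..1}"
    unfolding g_def using z r by (intro has_integral_Cauchy_circle f) simp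
  then have "f z = (LINT t:{0..1}|lborel. g t)"
    using set_borel_integral_eq_integral(2)[OF g] by (simp add: integral_unique)
  then have "ennreal (cmod (f z)) \<le> (\<integral>\<^sup>+t. ennreal (norm (indicator {0..1} t *\<^sub>R g t)) \<partial>lborel)"
    using integral_norm_bound_ennreal[OF g[unfolded set_integrable_def]]
    by (simp add: set_lebesgue_integral_def)
  also have "\<dots> \<le> (\<integral>\<^sup>+t. ennreal (2 * cmod (f (circlepath a r t))) * indicator {0..1} t \<partial>lborel)"
  proof (intro nn_integral_mono)
    fix t
    have "cmod (g t) \<le> cmod (f (circlepath a r t)) * (r / (r / 2))"
      unfolding g_def norm_mult norm_divide on_circle using far[of t] r
      by (intro mult_left_mono divide_left_mono mult_pos_pos norm_ge_zero) linarith+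
    then have "ennreal (cmod (g t)) \<le> ennreal (2 * cmod (f (circlepath a r t)))"
      using r by (intro ennreal_leI) simp
    then show "ennreal (norm (indicator {0..1} t *\<^sub>R g t))
        \<le> ennreal (2 * cmod (f (circlepath a r t))) * indicator {0..1} t"
      by (auto split: split_indicator)
  qed
  finally show ?thesis .
qed

lemma nn_integral_lborel_shift:
  fixes g :: "'a::euclidean_space \<Rightarrow> ennreal"
  assumes "g \<in> borel_measurable borel"
  shows "(\<integral>\<^sup>+x. g (x + c) \<partial>lborel) = (\<integral>\<^sup>+x. g x \<partial>lborel)"
proof -
  have "(\<integral>\<^sup>+x. g x \<partial>lborel) = (\<integral>\<^sup>+x. g x \<partial>distr lborel borel ((+) c))"
    by (simp add: lborel_distr_plus)
  also have "\<dots> = (\<integral>\<^sup>+x. g (x + c) \<partial>lborel)"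
    using assms by (subst nn_integral_distr) (auto simp: add.commute)
  finally show ?thesis ..
qed

text \<open>Averaging Cauchy's formula over circles of a fixed radius with variable centre needs only
  the translation invariance of Lebesgue measure, and no polar coordinates.\<close>
lemma norm_le_area_mean:
  assumes f: "f holomorphic_on ball z r" and r: "0 < r"
  shows "ennreal (cmod (f z) * (pi * (r / 4)\<^sup>2)) \<le> 2 * lp_integral 1 (ball z r) f"
proof -
  define G where "G w = ennreal (cmod (2 * f w)) * indicator (ball z r) w" for w
  have G[measurable]: "G \<in> borel_measurable borel"
    unfolding G_def[abs_def] using f by (intro borel_measurable_norm_indicator holomorphic_intros) auto
  define e where "e = circlepath 0 (r / 2)"
  have e[measurable]: "e \<in> borel_measurable borel"
    unfolding e_def circlepath by (intro borel_measurable_continuous_onI continuous_intros)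
  have circle: "circlepath a (r / 2) t = a + e t" "cmod (e t) = r / 2" for a t
    using r by (simp_all add: e_def circlepath norm_mult)
  have mean: "ennreal (cmod (f z)) * indicator (ball z (r / 4)) a
      \<le> (\<integral>\<^sup>+t. G (a + e t) * indicator {0..1} t \<partial>lborel)" for a
  proof (cases "a \<in> ball z (r / 4)")
    case True
    have sub: "cball a (r / 2) \<subseteq> ball z r"
      using True r by (intro cball_subset_ball_iff[THEN iffD2]) (simp add: dist_commute)
    have "a + e t \<in> ball z r" for t
      using sub circle(2)[of t] by (auto simp: dist_norm subset_iff)
    then show ?thesis
      using norm_le_circle_mean_off_center[OF holomorphic_on_subset[OF f sub], of z] True r
      by (simp add: G_def circle dist_commute norm_mult)
  qed simp
  have "ennreal (cmod (f z) * (pi * (r / 4)\<^sup>2))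
      = (\<integral>\<^sup>+a. ennreal (cmod (f z)) * indicator (ball z (r / 4)) a \<partial>lborel)"
    using r by (subst nn_integral_cmult_indicator)
      (auto simp: emeasure_ball eval_unit_ball_vol simp flip: ennreal_mult)
  also have "\<dots> \<le> (\<integral>\<^sup>+a. (\<integral>\<^sup>+t. G (a + e t) * indicator {0..1::real} t \<partial>lborel) \<partial>lborel)"
    by (intro nn_integral_mono mean)
  also have "\<dots> = (\<integral>\<^sup>+t. (\<integral>\<^sup>+a. G (a + e t) * indicator {0..1::real} t \<partial>lborel) \<partial>lborel)"
    by (rule lborel_pair.Fubini') measurable
  also have "\<dots> = (\<integral>\<^sup>+t. (\<integral>\<^sup>+w. G w \<partial>lborel) * indicator {0..1::real} t \<partial>lborel)"
    by (intro nn_integral_cong) (simp add: nn_integral_multc nn_integral_lborel_shift)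
  also have "\<dots> = lp_integral 1 (ball z r) (\<lambda>w. 2 * f w)"
    by (subst nn_integral_cmult_indicator) (auto simp: lp_integral_def G_def[abs_def])
  also have "\<dots> = 2 * lp_integral 1 (ball z r) f"
    using f by (simp add: lp_integral_cmult borel_measurable_holomorphic_on)
  finally show ?thesis .
qed

text \<open>Integrates \<open>x \<le> s + s powr (1 - p) * x powr p\<close>, with \<open>s\<close> balancing the two terms.\<close>
lemma lp_integral_1_le_if_lp_integral_le:
  assumes D: "D \<in> sets borel" and f: "f \<in> borel_measurable (restrict_space lborel D)"
    and V: "emeasure lborel D = ennreal V" "0 < V"
    and p: "1 \<le> p" and A: "0 < A" "lp_integral p D f \<le> ennreal (A powr p)"
  shows "lp_integral 1 D f \<le> ennreal (2 * V * (A / V powr (1 / p)))"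
proof -
  let ?M = "restrict_space lborel D"
  define s where "s = A / V powr (1 / p)"
  have s: "0 < s"
    using A V by (simp add: s_def)
  have "s powr (1 - p) * A powr p = s * (A / s) powr p"
    using s A by (simp add: powr_divide powr_diff)
  also have "A / s = V powr (1 / p)"
    using A V by (simp add: s_def)
  finally have balance: "s powr (1 - p) * A powr p = s * V"
    using V p by (simp add: powr_powr)
  have split: "x \<le> s + s powr (1 - p) * x powr p" if "0 \<le> x" for x
  proof (cases "x \<le> s")
    case False
    then have "x = x powr (1 - p) * x powr p"
      using s by (simp flip: powr_add)
    also have "\<dots> \<le> s powr (1 - p) * x powr p"
      using False s p by (intro mult_right_mono powr_mono2') auto
    finally show ?thesis using s by simp
  qed (simp add: add_increasing2)
  have "lp_integral 1 D f \<le> (\<integral>\<^sup>+z. ennreal s + ennreal (s powr (1 - p)) * ennreal (cmod (f z) powr p) \<partial>?M)"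
    unfolding lp_integral_eq_restrict_space[OF D] using split s
    by (intro nn_integral_mono) (simp add: ennreal_leI flip: ennreal_mult ennreal_plus)
  also have "\<dots> = ennreal s * ennreal V + ennreal (s powr (1 - p)) * lp_integral p D f"
    using D V f by (subst nn_integral_add) (auto simp: nn_integral_cmult lp_integral_eq_restrict_space
        emeasure_restrict_space space_restrict_space)
  also have "\<dots> \<le> ennreal s * ennreal V + ennreal (s powr (1 - p)) * ennreal (A powr p)"
    using A by (intro add_left_mono mult_left_mono) auto
  also have "\<dots> = ennreal (2 * V * s)"
    using s V balance by (simp add: mult.commute flip: ennreal_mult ennreal_plus)
  finally show ?thesis
    by (simp add: s_def)
qed

lemma norm_le_lp_norm:
  assumes D: "open D" and p: "1 \<le> p" and f: "f \<in> OLp (ereal p) D"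
    and r: "0 < r" "ball z r \<subseteq> D"
  shows "cmod (f z) \<le> 64 / (pi * r\<^sup>2) powr (1 / p) * lp_norm p D f"
proof -
  define V where "V = pi * r\<^sup>2"
  have V: "0 < V" "emeasure lborel (ball z r) = ennreal V"
    using r by (simp_all add: V_def emeasure_ball eval_unit_ball_vol)
  have f_hol: "f holomorphic_on ball z r"
    using f r holomorphic_on_subset by (auto simp: OLp_ereal_iff)
  have "cmod (f z) * V powr (1 / p) / 64 \<le> A" if A: "lp_norm p D f < A" for A
  proof -
    have A_pos: "0 < A"
      using A le_less_trans[OF lp_norm_nonneg] by blast
    have "lp_integral p (ball z r) f \<le> lp_integral p D f"
      using r(2) by (rule lp_integral_mono)
    also have "\<dots> \<le> ennreal (A powr p)"
      using f p A A_pos by (subst lp_integral_le_iff_lp_norm_le) auto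
    finally have "lp_integral 1 (ball z r) f \<le> ennreal (2 * V * (A / V powr (1 / p)))"
      using f_hol V p A_pos by (intro lp_integral_1_le_if_lp_integral_le borel_measurable_holomorphic_on) auto
    then have "2 * lp_integral 1 (ball z r) f \<le> 2 * ennreal (2 * V * (A / V powr (1 / p)))"
      by (intro mult_left_mono) auto
    with norm_le_area_mean[OF f_hol r(1)]
    have "ennreal (cmod (f z) * (pi * (r / 4)\<^sup>2)) \<le> 2 * ennreal (2 * V * (A / V powr (1 / p)))"
      by (rule order_trans)
    then have "cmod (f z) * (pi * (r / 4)\<^sup>2) \<le> 4 * V * (A / V powr (1 / p))"
      using V A_pos by (simp add: ennreal_mult[symmetric] flip: ennreal_numeral)
    also have "pi * (r / 4)\<^sup>2 = V / 16"
      by (simp add: V_def power_divide)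
    finally show ?thesis
      using V by (simp add: field_simps)
  qed
  then have "cmod (f z) * V powr (1 / p) / 64 \<le> lp_norm p D f"
    by (rule dense_ge)
  then show ?thesis
    using r by (simp add: V_def field_simps)
qed

section \<open>The complete metric\<close>

definition saturation :: "real \<Rightarrow> real" where
  "saturation x = x / (1 + x)"

lemma saturation_nonneg: "0 \<le> x \<Longrightarrow> 0 \<le> saturation x"
  by (simp add: saturation_def)

lemma saturation_le_1: "0 \<le> x \<Longrightarrow> saturation x \<le> 1"
  by (simp add: saturation_def)

lemma saturation_le_iff: "0 \<le> x \<Longrightarrow> 0 \<le> y \<Longrightarrow> saturation x \<le> saturation y \<longleftrightarrow> x \<le> y"
  by (simp add: saturation_def field_simps)

lemma saturation_eq_0_iff: "0 \<le> x \<Longrightarrow> saturation x = 0 \<longleftrightarrow> x = 0"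
  by (auto simp: saturation_def)

lemma saturation_subadditive:
  assumes "0 \<le> x" "0 \<le> y"
  shows "saturation (x + y) \<le> saturation x + saturation y"
proof -
  have "saturation (x + y) = x / (1 + (x + y)) + y / (1 + (x + y))"
    by (simp add: saturation_def add_divide_distrib)
  also have "\<dots> \<le> saturation x + saturation y"
    unfolding saturation_def using assms by (intro add_mono divide_left_mono mult_pos_pos) auto
  finally show ?thesis .
qed

definition frechet_sum :: "(nat \<Rightarrow> real) \<Rightarrow> real" where
  "frechet_sum a = (\<Sum>j. (1/2) ^ Suc j * saturation (a j))"

context
  fixes a :: "nat \<Rightarrow> real"
  assumes a: "\<And>j. 0 \<le> a j"
begin

lemma frechet_term_nonneg: "0 \<le> (1/2) ^ Suc j * saturation (a j)"
  using a by (simp add: saturation_nonneg)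

lemma frechet_term_le: "(1/2) ^ Suc j * saturation (a j) \<le> (1/2) ^ Suc j"
  using a by (intro mult_left_le saturation_le_1) auto

lemma norm_frechet_term_le: "norm ((1/2) ^ Suc j * saturation (a j)) \<le> (1/2) ^ Suc j"
  using frechet_term_nonneg frechet_term_le by (simp only: real_norm_def abs_of_nonneg)

lemma summable_frechet: "summable (\<lambda>j. (1/2) ^ Suc j * saturation (a j))"
  using norm_frechet_term_le by (rule summable_comparison_test'[rotated]) (simp add: summable_geometric)

lemma frechet_sum_nonneg: "0 \<le> frechet_sum a"
  unfolding frechet_sum_def by (intro suminf_nonneg summable_frechet frechet_term_nonneg)

lemma frechet_term_le_sum: "(1/2) ^ Suc j * saturation (a j) \<le> frechet_sum a"
  using sum_le_suminf[OF summable_frechet, of "{j}"] frechet_term_nonneg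
  unfolding frechet_sum_def by (simp del: power_Suc)

lemma frechet_sum_eq_0_iff: "frechet_sum a = 0 \<longleftrightarrow> (\<forall>j. a j = 0)"
proof
  assume "frechet_sum a = 0"
  then have "(1/2) ^ Suc j * saturation (a j) = 0" for j
    using frechet_term_le_sum[of j] frechet_term_nonneg[of j] by linarith
  then show "\<forall>j. a j = 0"
    using a by (simp add: saturation_eq_0_iff)
qed (simp add: frechet_sum_def saturation_def)

end

lemma frechet_sum_subadditive:
  assumes a: "\<And>j. 0 \<le> a j" and b: "\<And>j. 0 \<le> b j" and c: "\<And>j. 0 \<le> c j" "\<And>j. c j \<le> a j + b j"
  shows "frechet_sum c \<le> frechet_sum a + frechet_sum b"
proof -
  have "saturation (c j) \<le> saturation (a j) + saturation (b j)" for j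
  proof -
    have "saturation (c j) \<le> saturation (a j + b j)"
      using a[of j] b[of j] c[of j] by (simp add: saturation_le_iff)
    also have "\<dots> \<le> saturation (a j) + saturation (b j)"
      using a b by (intro saturation_subadditive)
    finally show ?thesis .
  qed
  then have "(1/2) ^ Suc j * saturation (c j)
      \<le> (1/2) ^ Suc j * saturation (a j) + (1/2) ^ Suc j * saturation (b j)" for j
    by (simp add: distrib_left[symmetric] mult_left_mono del: power_Suc)
  then have "frechet_sum c
      \<le> (\<Sum>j. (1/2) ^ Suc j * saturation (a j) + (1/2) ^ Suc j * saturation (b j))"
    unfolding frechet_sum_def by (intro suminf_le summable_add summable_frechet a b c)
  also have "\<dots> = frechet_sum a + frechet_sum b"
    unfolding frechet_sum_def by (intro suminf_add[symmetric] summable_frechet a b)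
  finally show ?thesis .
qed

lemma frechet_sum_small_imp_term_small:
  fixes \<eta> :: real
  assumes "0 < \<eta>"
  obtains e where "0 < e"
    "\<And>a. (\<And>j. 0 \<le> a j) \<Longrightarrow> frechet_sum a < e \<Longrightarrow> a j < \<eta>"
proof
  show "0 < (1/2) ^ Suc j * saturation \<eta>"
    using assms by (simp add: saturation_def)
  fix a :: "nat \<Rightarrow> real"
  assume a: "\<And>j. 0 \<le> a j" and small: "frechet_sum a < (1/2) ^ Suc j * saturation \<eta>"
  have "(1/2) ^ Suc j * saturation (a j) < (1/2) ^ Suc j * saturation \<eta>"
    using frechet_term_le_sum[of a j, OF a] small by (rule le_less_trans)
  then have "\<not> saturation \<eta> \<le> saturation (a j)"
    by simp
  then show "a j < \<eta>"
    using assms a[of j] by (simp add: saturation_le_iff)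
qed

lemma frechet_sum_tendsto_0:
  assumes a: "\<And>k j. 0 \<le> a k j" and lim: "\<And>j. (\<lambda>k. a k j) \<longlonglongrightarrow> 0"
  shows "(\<lambda>k. frechet_sum (a k)) \<longlonglongrightarrow> 0"
proof -
  have "(\<lambda>k. \<Sum>j. (1/2) ^ Suc j * saturation (a k j)) \<longlonglongrightarrow> (\<Sum>j. (1/2) ^ Suc j * 0)"
  proof (rule tannerys_theorem[THEN conjunct2, THEN conjunct2])
    fix j
    have "(\<lambda>k. saturation (a k j)) \<longlonglongrightarrow> 0 / (1 + 0)"
      unfolding saturation_def by (intro tendsto_intros lim) simp
    then show "(\<lambda>k. (1/2) ^ Suc j * saturation (a k j)) \<longlonglongrightarrow> (1/2) ^ Suc j * 0"
      by (intro tendsto_mult tendsto_const) simp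
  next
    have "norm ((1/2) ^ Suc j * saturation (a k j)) \<le> (1/2) ^ Suc j" for j k
      using a by (rule norm_frechet_term_le)
    then show "\<forall>\<^sub>F (j, k) in sequentially \<times>\<^sub>F sequentially.
        norm ((1/2) ^ Suc j * saturation (a k j)) \<le> (1/2) ^ Suc j"
      by (intro always_eventually) auto
    show "summable (\<lambda>j. (1/2::real) ^ Suc j)"
      by (simp add: summable_geometric)
  qed simp
  then show ?thesis
    by (simp add: frechet_sum_def)
qed

locale OLbelow_space =
  fixes \<Omega> :: "complex set" and q :: ereal and p :: "nat \<Rightarrow> real"
  assumes open_\<Omega>: "open \<Omega>" and bounded_\<Omega>: "bounded \<Omega>" and admissible: "admissible_seq q p"
begin

abbreviation "X \<equiv> OLbelow q \<Omega>"
abbreviation "d \<equiv> OLdist \<Omega> p"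
abbreviation "N \<equiv> \<lambda>j. lp_norm (p j) \<Omega>"

lemma p_strict_mono: "strict_mono p"
  using admissible by (simp add: admissible_seq_def strict_mono_Suc_iff)

lemma p_gt_1: "1 < p j"
proof -
  have "p 0 \<le> p j"
    using p_strict_mono by (simp add: strict_mono_less_eq)
  then show ?thesis
    using admissible by (simp add: admissible_seq_def)
qed

lemma p_less_q: "ereal (p j) < q"
proof -
  have "ereal (p j) < ereal (p (Suc j))"
    using p_strict_mono by (simp add: strict_mono_Suc_iff)
  also have "\<dots> \<le> q"
  proof (rule LIMSEQ_le_const[of "\<lambda>j. ereal (p j)"])
    show "(\<lambda>j. ereal (p j)) \<longlonglongrightarrow> q"
      using admissible by (simp add: admissible_seq_def)
    show "\<exists>M. \<forall>n\<ge>M. ereal (p (Suc j)) \<le> ereal (p n)"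
      using p_strict_mono by (intro exI[of _ "Suc j"]) (simp add: strict_mono_less_eq)
  qed
  finally show ?thesis .
qed

lemma p_cofinal:
  assumes "ereal r < q"
  obtains j where "r \<le> p j"
proof -
  have "\<forall>\<^sub>F j in sequentially. ereal r < ereal (p j)"
    using admissible assms by (intro order_tendstoD) (auto simp: admissible_seq_def)
  then obtain j where "r < p j"
    by (auto simp: eventually_sequentially)
  then show ?thesis by (intro that[of j]) simp
qed

lemma X_holomorphic: "f \<in> X \<Longrightarrow> f holomorphic_on \<Omega>"
  by (simp add: OLbelow_def)

lemma X_zero_outside: "f \<in> X \<Longrightarrow> z \<notin> \<Omega> \<Longrightarrow> f z = 0"
  by (simp add: OLbelow_def)

lemma X_OLp: "f \<in> X \<Longrightarrow> f \<in> OLp (ereal (p j)) \<Omega>"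
  using p_gt_1[of j] p_less_q[of j] by (simp add: OLbelow_def)

lemma X_iff: "f \<in> X \<longleftrightarrow> (\<forall>z. z \<notin> \<Omega> \<longrightarrow> f z = 0) \<and> (\<forall>j. f \<in> OLp (ereal (p j)) \<Omega>)"
proof
  assume f: "(\<forall>z. z \<notin> \<Omega> \<longrightarrow> f z = 0) \<and> (\<forall>j. f \<in> OLp (ereal (p j)) \<Omega>)"
  then have hol: "f holomorphic_on \<Omega>"
    by (simp add: OLp_ereal_iff)
  have "f \<in> OLp (ereal r) \<Omega>" if r: "1 \<le> r" "ereal r < q" for r
  proof -
    obtain j where "r \<le> p j"
      using p_cofinal r(2) by blast
    then have "lp_integral r \<Omega> f \<le> emeasure lborel \<Omega> + lp_integral (p j) \<Omega> f"
      using open_\<Omega> hol r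
      by (intro lp_integral_le_lp_integral_add_emeasure borel_measurable_holomorphic_on) auto
    also have "\<dots> < top"
      using f emeasure_bounded_finite[OF bounded_\<Omega>] by (simp add: OLp_ereal_iff)
    finally show ?thesis
      using hol by (simp add: OLp_ereal_iff)
  qed
  then show "f \<in> X"
    using f hol by (simp add: OLbelow_def)
qed (simp add: X_zero_outside X_OLp)

lemma X_lincomb:
  assumes "f \<in> X" "g \<in> X"
  shows "(\<lambda>z. a * f z + b * g z) \<in> X"
  using assms p_gt_1 by (simp add: X_iff OLp_lincomb[OF open_\<Omega>] less_imp_le)

lemma X_diff:
  assumes "f \<in> X" "g \<in> X"
  shows "(\<lambda>z. f z - g z) \<in> X"
  using X_lincomb[OF assms, of 1 "-1"] by simp

lemma N_triangle:
  assumes "f \<in> X" "g \<in> X"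
  shows "N j (\<lambda>z. f z + g z) \<le> N j f + N j g"
  using assms p_gt_1[of j] by (intro lp_norm_triangle open_\<Omega> X_OLp) auto

lemma N_cmult:
  assumes "f \<in> X"
  shows "N j (\<lambda>z. c * f z) = cmod c * N j f"
  using assms p_gt_1[of j] open_\<Omega>
  by (intro lp_norm_cmult borel_measurable_holomorphic_on X_holomorphic) auto

lemma norm_le_N:
  assumes "f \<in> X" "0 < r" "ball z r \<subseteq> \<Omega>"
  shows "cmod (f z) \<le> 64 / (pi * r\<^sup>2) powr (1 / p j) * N j f"
  using assms p_gt_1[of j] by (intro norm_le_lp_norm open_\<Omega> X_OLp) auto

lemma X_eq_if_N_zero:
  assumes f: "f \<in> X" and g: "g \<in> X" and "N j (\<lambda>z. f z - g z) = 0"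
  shows "f = g"
proof
  fix z
  show "f z = g z"
  proof (cases "z \<in> \<Omega>")
    case True
    then obtain r where "0 < r" "ball z r \<subseteq> \<Omega>"
      using open_\<Omega> open_contains_ball by blast
    from norm_le_N[OF X_diff[OF f g] this, of j] show ?thesis
      using assms(3) by simp
  qed (use f g in \<open>simp add: X_zero_outside\<close>)
qed

lemma d_eq_frechet_sum: "d f g = frechet_sum (\<lambda>j. N j (\<lambda>z. f z - g z))"
  by (simp add: OLdist_def frechet_sum_def saturation_def)

sublocale Metric_space X d
proof
  fix f g h
  show "0 \<le> d f g"
    by (simp add: d_eq_frechet_sum frechet_sum_nonneg)
  show "d f g = d g f"
    by (simp add: d_eq_frechet_sum lp_norm_def lp_integral_def norm_minus_commute)
  show "d f g = 0 \<longleftrightarrow> f = g" if "f \<in> X" "g \<in> X"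
  proof
    show "f = g" if "d f g = 0"
      using that \<open>f \<in> X\<close> \<open>g \<in> X\<close> X_eq_if_N_zero by (simp add: d_eq_frechet_sum frechet_sum_eq_0_iff)
  qed (simp add: d_eq_frechet_sum frechet_sum_eq_0_iff lp_norm_def lp_integral_def)
  show "d f h \<le> d f g + d g h" if "f \<in> X" "g \<in> X" "h \<in> X"
    unfolding d_eq_frechet_sum
  proof (rule frechet_sum_subadditive)
    show "N j (\<lambda>z. f z - h z) \<le> N j (\<lambda>z. f z - g z) + N j (\<lambda>z. g z - h z)" for j
      using N_triangle[OF X_diff[OF that(1,2)] X_diff[OF that(2,3)], of j] by simp
  qed simp_all
qed

lemma d_tendsto_0:
  assumes "\<And>j. (\<lambda>k. N j (\<lambda>z. f z - g k z)) \<longlonglongrightarrow> 0"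
  shows "(\<lambda>k. d f (g k)) \<longlonglongrightarrow> 0"
  unfolding d_eq_frechet_sum using assms by (intro frechet_sum_tendsto_0) simp_all

lemma N_small_if_d_small:
  assumes "0 < \<eta>"
  obtains e where "0 < e" "\<And>f g. d f g < e \<Longrightarrow> N j (\<lambda>z. f z - g z) < \<eta>"
proof -
  obtain e where e: "0 < e" "\<And>a. (\<And>j. 0 \<le> a j) \<Longrightarrow> frechet_sum a < e \<Longrightarrow> a j < \<eta>"
    using frechet_sum_small_imp_term_small[OF assms, of j] by blast
  show ?thesis
    by (rule that[OF e(1)], rule e(2)) (simp_all add: d_eq_frechet_sum)
qed

lemma uniformly_close_if_d_small:
  assumes r: "0 < r" and \<eta>: "0 < \<eta>"
  obtains e where "0 < e"
    "\<And>f g z. f \<in> X \<Longrightarrow> g \<in> X \<Longrightarrow> d f g < e \<Longrightarrow> ball z r \<subseteq> \<Omega> \<Longrightarrow> cmod (f z - g z) < \<eta>"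
proof -
  define K where "K = 64 / (pi * r\<^sup>2) powr (1 / p 0)"
  have K: "0 < K"
    using r by (simp add: K_def)
  obtain e where e: "0 < e" "\<And>f g. d f g < e \<Longrightarrow> N 0 (\<lambda>z. f z - g z) < \<eta> / K"
    using N_small_if_d_small[of "\<eta> / K" 0] \<eta> K by auto
  have "cmod (f z - g z) < \<eta>" if "f \<in> X" "g \<in> X" "d f g < e" "ball z r \<subseteq> \<Omega>" for f g z
  proof -
    have "cmod (f z - g z) \<le> K * N 0 (\<lambda>z. f z - g z)"
      unfolding K_def using that by (intro norm_le_N X_diff r)
    also have "\<dots> < K * (\<eta> / K)"
      using e(2)[OF that(3)] K by (intro mult_strict_left_mono)
    finally show ?thesis
      using K by simp
  qed
  then show ?thesis
    using e(1) that by blast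
qed

lemma limitin_imp_pointwise:
  assumes "limitin mtopology g f sequentially" and z: "z \<in> \<Omega>"
  shows "(\<lambda>k. g k z) \<longlonglongrightarrow> f z"
proof (rule tendstoI)
  fix \<eta> :: real assume \<eta>: "0 < \<eta>"
  obtain r where r: "0 < r" "ball z r \<subseteq> \<Omega>"
    using open_\<Omega> open_contains_ball z by blast
  obtain e where e: "0 < e" "\<And>f g z. f \<in> X \<Longrightarrow> g \<in> X \<Longrightarrow> d f g < e \<Longrightarrow> ball z r \<subseteq> \<Omega> \<Longrightarrow> cmod (f z - g z) < \<eta>"
    using uniformly_close_if_d_small[OF r(1) \<eta>] by metis
  then have "f \<in> X" "\<forall>\<^sub>F k in sequentially. g k \<in> X \<and> d (g k) f < e"
    using assms(1) by (auto simp: limitin_metric)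
  from this(2) show "\<forall>\<^sub>F k in sequentially. dist (g k z) (f z) < \<eta>"
    by eventually_elim (use e(2) \<open>f \<in> X\<close> r(2) in \<open>simp add: dist_norm\<close>)
qed

lemma MCauchy_in_X: "MCauchy \<sigma> \<Longrightarrow> \<sigma> k \<in> X"
  by (auto simp: MCauchy_def)

lemma MCauchyD: "MCauchy \<sigma> \<Longrightarrow> 0 < e \<Longrightarrow> \<exists>K. \<forall>k\<ge>K. \<forall>m\<ge>K. d (\<sigma> k) (\<sigma> m) < e"
  by (simp add: MCauchy_def)

lemma MCauchy_imp_locally_uniform_limit:
  assumes \<sigma>: "MCauchy \<sigma>" and z: "z \<in> \<Omega>"
  shows "\<exists>e>0. cball z e \<subseteq> \<Omega> \<and> uniform_limit (cball z e) \<sigma> (\<lambda>z. lim (\<lambda>k. \<sigma> k z)) sequentially"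
proof -
  note \<sigma>X = MCauchy_in_X[OF \<sigma>]
  obtain r where r: "0 < r" "cball z r \<subseteq> \<Omega>"
    using open_\<Omega> open_contains_cball z by blast
  have "ball w (r / 2) \<subseteq> cball z r" if "w \<in> cball z (r / 2)" for w
    using that r(1) by (simp add: ball_subset_cball_iff dist_commute)
  then have sub: "ball w (r / 2) \<subseteq> \<Omega>" if "w \<in> cball z (r / 2)" for w
    using that r(2) by blast
  have "uniformly_Cauchy_on (cball z (r / 2)) \<sigma>"
    unfolding uniformly_Cauchy_on_def
  proof (intro allI impI)
    fix \<eta> :: real assume \<eta>: "0 < \<eta>"
    obtain e where e: "0 < e"
      "\<And>f g w. f \<in> X \<Longrightarrow> g \<in> X \<Longrightarrow> d f g < e \<Longrightarrow> ball w (r / 2) \<subseteq> \<Omega> \<Longrightarrow> cmod (f w - g w) < \<eta>"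
      using uniformly_close_if_d_small[of "r / 2" \<eta>] r(1) \<eta> by auto
    obtain M where "\<forall>m\<ge>M. \<forall>n\<ge>M. d (\<sigma> m) (\<sigma> n) < e"
      using MCauchyD[OF \<sigma> e(1)] by blast
    then show "\<exists>M. \<forall>w\<in>cball z (r / 2). \<forall>m\<ge>M. \<forall>n\<ge>M. dist (\<sigma> m w) (\<sigma> n w) < \<eta>"
      using e(2) \<sigma>X sub by (intro exI[of _ M]) (simp add: dist_norm)
  qed
  then have "uniform_limit (cball z (r / 2)) \<sigma> (\<lambda>z. lim (\<lambda>k. \<sigma> k z)) sequentially"
    using Cauchy_uniformly_convergent uniformly_convergent_uniform_limit_iff by blast
  moreover have "cball z (r / 2) \<subseteq> \<Omega>"
    using r by (auto simp: subset_iff)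
  ultimately show ?thesis
    using r(1) by (intro exI[of _ "r / 2"]) auto
qed

lemma MCauchy_tail_lp_integral_le:
  assumes \<sigma>: "MCauchy \<sigma>" and lim: "\<And>z. z \<in> \<Omega> \<Longrightarrow> (\<lambda>k. \<sigma> k z) \<longlonglongrightarrow> f z" and \<eta>: "0 < \<eta>"
  obtains K where "\<And>k. k \<ge> K \<Longrightarrow> lp_integral (p j) \<Omega> (\<lambda>z. f z - \<sigma> k z) \<le> ennreal (\<eta> powr p j)"
proof -
  note \<sigma>X = MCauchy_in_X[OF \<sigma>]
  obtain e where e: "0 < e" "\<And>f g. d f g < e \<Longrightarrow> N j (\<lambda>z. f z - g z) < \<eta>"
    using N_small_if_d_small[OF \<eta>] by metis
  obtain K where K: "\<forall>m\<ge>K. \<forall>k\<ge>K. d (\<sigma> m) (\<sigma> k) < e"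
    using MCauchyD[OF \<sigma> e(1)] by blast
  have "lp_integral (p j) \<Omega> (\<lambda>z. f z - \<sigma> k z) \<le> ennreal (\<eta> powr p j)" if k: "k \<ge> K" for k
  proof (rule lp_integral_Fatou)
    show "\<Omega> \<in> sets borel"
      using open_\<Omega> by simp
    show "(\<lambda>z. \<sigma> m z - \<sigma> k z) \<in> borel_measurable (restrict_space lborel \<Omega>)" for m
      using \<sigma>X by (intro borel_measurable_holomorphic_on holomorphic_intros X_holomorphic)
    show "(\<lambda>m. \<sigma> m z - \<sigma> k z) \<longlonglongrightarrow> f z - \<sigma> k z" if "z \<in> \<Omega>" for z
      using that by (intro tendsto_intros lim)
    have "lp_integral (p j) \<Omega> (\<lambda>z. \<sigma> m z - \<sigma> k z) \<le> ennreal (\<eta> powr p j)" if "m \<ge> K" for m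
      using e(2)[OF K[rule_format, OF that k]] p_gt_1[of j] \<eta> \<sigma>X
      by (subst lp_integral_le_iff_lp_norm_le) (auto intro: X_OLp X_diff)
    then show "\<forall>\<^sub>F m in sequentially. lp_integral (p j) \<Omega> (\<lambda>z. \<sigma> m z - \<sigma> k z) \<le> ennreal (\<eta> powr p j)"
      by (auto simp: eventually_sequentially)
  qed (use p_gt_1[of j] in simp)
  then show ?thesis
    by (rule that)
qed

lemma MCauchy_limit_in_X:
  assumes \<sigma>: "MCauchy \<sigma>" and hol: "f holomorphic_on \<Omega>" and out: "\<And>z. z \<notin> \<Omega> \<Longrightarrow> f z = 0"
    and lim: "\<And>z. z \<in> \<Omega> \<Longrightarrow> (\<lambda>k. \<sigma> k z) \<longlonglongrightarrow> f z"
  shows "f \<in> X"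
proof -
  have "f \<in> OLp (ereal (p j)) \<Omega>" for j
  proof -
    obtain k where "\<And>m. m \<ge> k \<Longrightarrow> lp_integral (p j) \<Omega> (\<lambda>z. f z - \<sigma> m z) \<le> ennreal (1 powr p j)"
      using MCauchy_tail_lp_integral_le[OF \<sigma> lim zero_less_one] by blast
    then have k: "lp_integral (p j) \<Omega> (\<lambda>z. f z - \<sigma> k z) \<le> ennreal (1 powr p j)"
      by blast
    note \<sigma>X = MCauchy_in_X[OF \<sigma>, of k]
    then have "(\<lambda>z. f z - \<sigma> k z) \<in> OLp (ereal (p j)) \<Omega>"
      using le_less_trans[OF k ennreal_less_top] hol X_holomorphic
      by (auto simp: OLp_ereal_iff intro!: holomorphic_intros)
    from OLp_lincomb[OF open_\<Omega> _ this X_OLp[OF \<sigma>X], of 1 1] show ?thesis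
      using p_gt_1[of j] by simp
  qed
  then show ?thesis
    using out by (simp add: X_iff)
qed

lemma mcomplete_OLbelow: mcomplete
  unfolding mcomplete_def
proof (intro allI impI)
  fix \<sigma> assume \<sigma>: "MCauchy \<sigma>"
  note \<sigma>X = MCauchy_in_X[OF \<sigma>]
  define f where "f z = lim (\<lambda>k. \<sigma> k z)" for z
  note locally_uniform = MCauchy_imp_locally_uniform_limit[OF \<sigma>, folded f_def]
  have pointwise: "(\<lambda>k. \<sigma> k z) \<longlonglongrightarrow> f z" if "z \<in> \<Omega>" for z
    using locally_uniform[OF that] tendsto_uniform_limitI by fastforce
  have "f holomorphic_on \<Omega>"
    by (rule holomorphic_uniform_sequence[OF open_\<Omega>, of \<sigma>])
      (use \<sigma>X X_holomorphic locally_uniform in auto)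
  moreover have "f z = 0" if "z \<notin> \<Omega>" for z
    using \<sigma>X that by (simp add: f_def X_zero_outside)
  ultimately have f: "f \<in> X"
    using \<sigma> pointwise by (intro MCauchy_limit_in_X)
  have "(\<lambda>k. d f (\<sigma> k)) \<longlonglongrightarrow> 0"
  proof (rule d_tendsto_0, rule tendstoI)
    fix j and \<eta> :: real assume \<eta>: "0 < \<eta>"
    obtain K where K: "\<And>k. k \<ge> K \<Longrightarrow> lp_integral (p j) \<Omega> (\<lambda>z. f z - \<sigma> k z) \<le> ennreal ((\<eta> / 2) powr p j)"
      using MCauchy_tail_lp_integral_le[OF \<sigma> pointwise, of "\<eta> / 2"] \<eta> by auto
    have "dist (N j (\<lambda>z. f z - \<sigma> k z)) 0 < \<eta>" if "k \<ge> K" for k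
    proof -
      have "N j (\<lambda>z. f z - \<sigma> k z) \<le> \<eta> / 2"
        using K[OF that] p_gt_1[of j] \<eta> X_OLp[OF X_diff[OF f \<sigma>X[of k]]]
        by (subst (asm) lp_integral_le_iff_lp_norm_le) auto
      then show ?thesis
        using \<eta> by simp
    qed
    then show "\<forall>\<^sub>F k in sequentially. dist (N j (\<lambda>z. f z - \<sigma> k z)) 0 < \<eta>"
      unfolding eventually_sequentially by blast
  qed
  then show "\<exists>f. limitin mtopology \<sigma> f sequentially"
    using f \<sigma>X by (auto simp: limitin_metric_dist_null commute)
qed

end

section \<open>Baire category\<close>

definition dense_gdelta :: "'a set \<Rightarrow> ('a \<Rightarrow> 'a \<Rightarrow> real) \<Rightarrow> 'a set \<Rightarrow> bool" where
  "dense_gdelta X d A \<longleftrightarrow> ms_dense X d A \<and> ms_gdelta X d A"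

context Metric_space
begin

lemma ms_open_iff_openin: "ms_open M d U \<longleftrightarrow> openin mtopology U"
proof -
  have "(\<forall>y\<in>M. d x y < r \<longrightarrow> y \<in> U) \<longleftrightarrow> mball x r \<subseteq> U" if "x \<in> M" for x r
    using that by auto
  then show ?thesis
    unfolding ms_open_def openin_mtopology by blast
qed

lemma ms_dense_iff_closure_of: "ms_dense M d A \<longleftrightarrow> A \<subseteq> M \<and> mtopology closure_of A = M"
proof -
  have "mtopology closure_of A = {x \<in> M. \<forall>r>0. \<exists>y\<in>A. d x y < r}" if "A \<subseteq> M"
    unfolding metric_closure_of using that by (intro Collect_cong conj_cong all_cong) auto
  moreover have "{x \<in> M. P x} = M \<longleftrightarrow> (\<forall>x\<in>M. P x)" for P
    by blast
  ultimately show ?thesis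
    unfolding ms_dense_def by (intro conj_cong) simp_all
qed

lemma ms_gdelta_iff_gdelta_in: "ms_gdelta M d A \<longleftrightarrow> gdelta_in mtopology A"
proof
  assume "ms_gdelta M d A"
  then obtain U :: "nat \<Rightarrow> 'a set" where U: "\<And>n. openin mtopology (U n)" "A = (\<Inter>n. U n)"
    by (auto simp: ms_gdelta_def ms_open_iff_openin)
  show "gdelta_in mtopology A"
    unfolding U(2) by (rule gdelta_in_Inter) (use U(1) in \<open>auto intro: open_imp_gdelta_in\<close>)
next
  assume "gdelta_in mtopology A"
  then show "ms_gdelta M d A"
    unfolding gdelta_in_descending ms_gdelta_def ms_open_iff_openin by blast
qed

lemma dense_gdelta_complement_Union_fsigma:
  assumes complete: mcomplete and "countable \<A>"
    and fsigma: "\<And>A. A \<in> \<A> \<Longrightarrow> fsigma_in mtopology A"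
    and codense: "\<And>A. A \<in> \<A> \<Longrightarrow> mtopology closure_of (M - A) = M"
  shows "dense_gdelta M d (M - \<Union>\<A>)"
proof -
  have "\<exists>F :: nat \<Rightarrow> 'a set. (\<forall>n. closedin mtopology (F n)) \<and> \<Union>(range F) = A" if "A \<in> \<A>" for A
    using fsigma[OF that] unfolding fsigma_in_ascending by blast
  then obtain F :: "'a set \<Rightarrow> nat \<Rightarrow> 'a set"
    where F: "\<And>A n. A \<in> \<A> \<Longrightarrow> closedin mtopology (F A n)" "\<And>A. A \<in> \<A> \<Longrightarrow> \<Union>(range (F A)) = A"
    by metis
  have "mtopology interior_of \<Union>(\<Union>A\<in>\<A>. range (F A)) = {}"
  proof (rule metric_Baire_category_alt[OF complete])
    show "countable (\<Union>A\<in>\<A>. range (F A))"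
      using \<open>countable \<A>\<close> by simp
    fix T assume "T \<in> (\<Union>A\<in>\<A>. range (F A))"
    then obtain A n where A: "A \<in> \<A>" and T: "T = F A n"
      by blast
    have "mtopology interior_of T \<subseteq> mtopology interior_of A"
      using F(2)[OF A] by (intro interior_of_mono) (auto simp: T)
    also have "mtopology interior_of A = {}"
      using codense[OF A] by (simp add: interior_of_closure_of)
    finally show "closedin mtopology T \<and> mtopology interior_of T = {}"
      using F(1)[OF A] by (simp add: T)
  qed
  moreover have "\<Union>(\<Union>A\<in>\<A>. range (F A)) = (\<Union>A\<in>\<A>. \<Union>(range (F A)))"
    by blast
  then have "\<Union>(\<Union>A\<in>\<A>. range (F A)) = \<Union>\<A>"
    using F(2) by simp
  ultimately have "mtopology closure_of (M - \<Union>\<A>) = M"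
    using closure_of_complement[of mtopology "\<Union>\<A>"] by simp
  moreover have "gdelta_in mtopology (M - \<Union>\<A>)"
    using \<open>countable \<A>\<close> fsigma gdelta_in_topspace[of mtopology]
    by (intro gdelta_in_diff fsigma_in_Union) auto
  ultimately show ?thesis
    by (simp add: dense_gdelta_def ms_dense_iff_closure_of ms_gdelta_iff_gdelta_in)
qed

end

context OLbelow_space
begin

lemma limitin_perturbation:
  assumes f: "f \<in> X" and h: "h \<in> X" and t: "t \<longlonglongrightarrow> 0"
  shows "limitin mtopology (\<lambda>k z. f z + t k * h z) f sequentially"
proof -
  have "(\<lambda>k. d f (\<lambda>z. f z + t k * h z)) \<longlonglongrightarrow> 0"
  proof (rule d_tendsto_0)
    fix j
    have "N j (\<lambda>z. f z - (f z + t k * h z)) = cmod (t k) * N j h" for k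
      using N_cmult[OF h, of j "- t k"] by simp
    then show "(\<lambda>k. N j (\<lambda>z. f z - (f z + t k * h z))) \<longlonglongrightarrow> 0"
      using tendsto_mult_left_zero[OF tendsto_norm_zero[OF t], of "N j h"] by simp
  qed
  moreover have "(\<lambda>z. f z + t k * h z) \<in> X" for k
    using X_lincomb[OF f h, of 1 "t k"] by simp
  ultimately show ?thesis
    using f by (simp add: limitin_metric_dist_null commute)
qed

lemma closure_complement_proper_subspace:
  assumes h: "h \<in> X" "h \<notin> A"
    and subspace: "\<And>f g a b. f \<in> A \<Longrightarrow> g \<in> A \<Longrightarrow> (\<lambda>z. a * f z + b * g z) \<in> A"
  shows "mtopology closure_of (X - A) = X"
proof
  show "mtopology closure_of (X - A) \<subseteq> X"
    using closure_of_subset_topspace by fastforce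
  show "X \<subseteq> mtopology closure_of (X - A)"
  proof
    fix f assume f: "f \<in> X"
    show "f \<in> mtopology closure_of (X - A)"
    proof (cases "f \<in> A")
      case True
      define t where "t k = complex_of_real (inverse (real (Suc k)))" for k
      have "t \<longlonglongrightarrow> 0"
        using tendsto_of_real[OF LIMSEQ_inverse_real_of_nat] unfolding t_def[abs_def] of_real_0 .
      define g where "g k = (\<lambda>z. f z + t k * h z)" for k
      have "g k \<notin> A" for k
      proof
        assume "g k \<in> A"
        then have "(\<lambda>z. inverse (t k) * g k z + - inverse (t k) * f z) \<in> A"
          using True by (rule subspace)
        moreover have "t k \<noteq> 0"
          unfolding t_def of_real_eq_0_iff by simp
        then have "inverse (t k) * g k z + - inverse (t k) * f z = h z" for z
          by (simp add: g_def field_simps)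
        ultimately show False
          using h(2) by simp
      qed
      moreover have "g k \<in> X" for k
        using X_lincomb[OF f h(1), of 1 "t k"] by (simp add: g_def)
      moreover have "limitin mtopology g f sequentially"
        unfolding g_def[abs_def] using f h(1) \<open>t \<longlonglongrightarrow> 0\<close> by (rule limitin_perturbation)
      ultimately show ?thesis
        using f by (auto simp: closure_of_sequentially intro!: exI[of _ g])
    qed (use f closure_of_subset[of "X - A" mtopology] in auto)
  qed
qed

lemma closedin_norm_le:
  assumes "D \<subseteq> \<Omega>"
  shows "closedin mtopology {g \<in> X. \<forall>z\<in>D. cmod (g z) \<le> C}"
  unfolding metric_closedin_iff_sequentially_closed
proof (intro conjI allI impI)
  fix \<sigma> f assume \<sigma>: "range \<sigma> \<subseteq> {g \<in> X. \<forall>z\<in>D. cmod (g z) \<le> C} \<and> limitin mtopology \<sigma> f sequentially"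
  have "cmod (f z) \<le> C" if "z \<in> D" for z
  proof (rule tendsto_upperbound[OF tendsto_norm])
    show "(\<lambda>k. \<sigma> k z) \<longlonglongrightarrow> f z"
      using \<sigma> that assms by (intro limitin_imp_pointwise) auto
    show "\<forall>\<^sub>F k in sequentially. cmod (\<sigma> k z) \<le> C"
      using \<sigma> that by (intro always_eventually) auto
  qed simp
  then show "f \<in> {g \<in> X. \<forall>z\<in>D. cmod (g z) \<le> C}"
    using \<sigma> limitin_mspace by auto
qed auto

lemma closedin_lp_integral_le:
  assumes D: "open D" "D \<subseteq> \<Omega>" and r: "0 < r"
  shows "closedin mtopology {g \<in> X. lp_integral r D g \<le> C}"
  unfolding metric_closedin_iff_sequentially_closed
proof (intro conjI allI impI)
  fix \<sigma> f assume \<sigma>: "range \<sigma> \<subseteq> {g \<in> X. lp_integral r D g \<le> C} \<and> limitin mtopology \<sigma> f sequentially"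
  have "lp_integral r D f \<le> C"
  proof (rule lp_integral_Fatou[OF _ _ r])
    show "D \<in> sets borel"
      using D(1) by simp
    show "\<sigma> k \<in> borel_measurable (restrict_space lborel D)" for k
      using \<sigma> D(2) by (intro borel_measurable_holomorphic_on holomorphic_on_subset[OF X_holomorphic]) auto
    show "(\<lambda>k. \<sigma> k z) \<longlonglongrightarrow> f z" if "z \<in> D" for z
      using \<sigma> D(2) that by (intro limitin_imp_pointwise) auto
    show "\<forall>\<^sub>F k in sequentially. lp_integral r D (\<sigma> k) \<le> C"
      using \<sigma> by (intro always_eventually) auto
  qed
  then show "f \<in> {g \<in> X. lp_integral r D g \<le> C}"
    using \<sigma> limitin_mspace by auto
qed auto

lemma fsigma_in_OLp:
  assumes D: "open D" "D \<subseteq> \<Omega>" and s: "0 < s"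
  shows "fsigma_in mtopology (X \<inter> OLp s D)"
proof (cases s)
  case (real r)
  have "lp_integral r D g < top \<longleftrightarrow> (\<exists>n::nat. lp_integral r D g \<le> of_nat n)" for g
    by (meson ennreal_Ex_less_of_nat less_imp_le le_less_trans of_nat_less_top)
  then have "X \<inter> OLp s D = (\<Union>n::nat. {g \<in> X. lp_integral r D g \<le> of_nat n})"
    using holomorphic_on_subset[OF X_holomorphic D(2)] by (auto simp: real OLp_ereal_iff)
  also have "fsigma_in mtopology \<dots>"
    using D s real by (intro fsigma_in_Union) (auto intro: closed_imp_fsigma_in closedin_lp_integral_le)
  finally show ?thesis .
next
  case PInf
  have bounded_iff_nat: "bounded (g ` D) \<longleftrightarrow> (\<exists>n::nat. \<forall>z\<in>D. cmod (g z) \<le> real n)" for g :: "complex \<Rightarrow> complex"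
  proof
    assume "bounded (g ` D)"
    then obtain M where M: "\<forall>z\<in>D. cmod (g z) \<le> M"
      by (auto simp: bounded_iff)
    obtain n :: nat where "M \<le> real n"
      using real_arch_simple by blast
    then show "\<exists>n::nat. \<forall>z\<in>D. cmod (g z) \<le> real n"
      using M order_trans by blast
  qed (auto simp: bounded_iff)
  have "X \<inter> OLp s D = {g \<in> X. bounded (g ` D)}"
    using holomorphic_on_subset[OF X_holomorphic D(2)] by (auto simp: PInf OLp_PInf_iff)
  also have "\<dots> = (\<Union>n::nat. {g \<in> X. \<forall>z\<in>D. cmod (g z) \<le> real n})"
    unfolding bounded_iff_nat by blast
  also have "fsigma_in mtopology \<dots>"
    using D by (intro fsigma_in_Union) (auto intro: closed_imp_fsigma_in closedin_norm_le)
  finally show ?thesis .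
qed (use s in simp)

lemma dense_gdelta_notin_OLp:
  assumes "countable \<D>"
    and \<D>: "\<And>s D. (s, D) \<in> \<D> \<Longrightarrow> 1 \<le> s \<and> open D \<and> D \<subseteq> \<Omega> \<and> (\<exists>h\<in>X. h \<notin> OLp s D)"
  shows "dense_gdelta X d {g \<in> X. \<forall>(s, D)\<in>\<D>. g \<notin> OLp s D}"
proof -
  have "{g \<in> X. \<forall>(s, D)\<in>\<D>. g \<notin> OLp s D} = X - \<Union>((\<lambda>(s, D). X \<inter> OLp s D) ` \<D>)"
    by auto
  also have "dense_gdelta X d \<dots>"
  proof (rule dense_gdelta_complement_Union_fsigma[OF mcomplete_OLbelow])
    show "countable ((\<lambda>(s, D). X \<inter> OLp s D) ` \<D>)"
      using \<open>countable \<D>\<close> by (rule countable_image)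
    fix A assume "A \<in> (\<lambda>(s, D). X \<inter> OLp s D) ` \<D>"
    then obtain s D where A: "A = X \<inter> OLp s D" "(s, D) \<in> \<D>"
      by auto
    from \<D>[OF A(2)] obtain h where s: "1 \<le> s" and D: "open D" "D \<subseteq> \<Omega>" and h: "h \<in> X" "h \<notin> OLp s D"
      by blast
    have "0 < s"
      using s by (rule less_le_trans[rotated]) simp
    then show "fsigma_in mtopology A"
      unfolding A using D by (intro fsigma_in_OLp)
    show "mtopology closure_of (X - A) = X"
      using h D s by (intro closure_complement_proper_subspace[of h])
        (auto simp: A intro!: X_lincomb OLp_lincomb)
  qed
  finally show ?thesis .
qed

end

section \<open>Holomorphic logarithms\<close>

lemma contour_integral_eq_add_linepath:
  assumes S: "open S" and f: "f holomorphic_on S"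
    and loops: "\<And>\<gamma>. valid_path \<gamma> \<Longrightarrow> path_image \<gamma> \<subseteq> S \<Longrightarrow> pathfinish \<gamma> = pathstart \<gamma> \<Longrightarrow> contour_integral \<gamma> f = 0"
    and \<alpha>: "valid_path \<alpha>" "path_image \<alpha> \<subseteq> S" "pathfinish \<alpha> = x"
    and \<beta>: "valid_path \<beta>" "path_image \<beta> \<subseteq> S" "pathfinish \<beta> = y"
    and start: "pathstart \<alpha> = pathstart \<beta>" and segment: "closed_segment x y \<subseteq> S"
  shows "contour_integral \<beta> f = contour_integral \<alpha> f + contour_integral (linepath x y) f"
proof -
  let ?loop = "\<alpha> +++ linepath x y +++ reversepath \<beta>"
  have integrable: "f contour_integrable_on \<alpha>" "f contour_integrable_on \<beta>"
      "f contour_integrable_on linepath x y"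
    using contour_integrable_holomorphic_simple[OF f S] \<alpha> \<beta> segment by auto
  have "contour_integral ?loop f = 0"
    using \<alpha> \<beta> start segment
    by (intro loops) (auto intro!: valid_path_join simp: path_image_join valid_path_reversepath)
  moreover have "contour_integral ?loop f
      = contour_integral \<alpha> f + (contour_integral (linepath x y) f - contour_integral \<beta> f)"
    using \<alpha> \<beta> integrable
    by (simp add: contour_integral_reversepath contour_integrable_reversepath valid_path_reversepath)
  ultimately show ?thesis
    by (simp add: algebra_simps)
qed

lemma holomorphic_primitive_if_loop_integrals_zero:
  assumes S: "open S" "connected S" and f: "f holomorphic_on S"
    and loops: "\<And>\<gamma>. valid_path \<gamma> \<Longrightarrow> path_image \<gamma> \<subseteq> S \<Longrightarrow> pathfinish \<gamma> = pathstart \<gamma> \<Longrightarrow> contour_integral \<gamma> f = 0"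
  obtains F where "\<And>z. z \<in> S \<Longrightarrow> (F has_field_derivative f z) (at z)"
proof (cases "S = {}")
  case False
  then obtain b where b: "b \<in> S" by blast
  have "\<exists>\<gamma>. valid_path \<gamma> \<and> path_image \<gamma> \<subseteq> S \<and> pathstart \<gamma> = b \<and> pathfinish \<gamma> = z" if "z \<in> S" for z
    using connected_open_polynomial_connected[OF S b that] valid_path_polynomial_function by blast
  then obtain \<gamma> where \<gamma>: "\<And>z. z \<in> S \<Longrightarrow>
      valid_path (\<gamma> z) \<and> path_image (\<gamma> z) \<subseteq> S \<and> pathstart (\<gamma> z) = b \<and> pathfinish (\<gamma> z) = z"
    by metis
  define F where "F z = contour_integral (\<gamma> z) f" for z
  have "(F has_field_derivative f x) (at x)" if x: "x \<in> S" for x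
  proof -
    obtain e where e: "0 < e" "ball x e \<subseteq> S"
      using S(1) x open_contains_ball by blast
    obtain H where H: "\<And>y. y \<in> ball x e \<Longrightarrow> (H has_field_derivative f y) (at y within ball x e)"
      using holomorphic_convex_primitive'[OF _ _ holomorphic_on_subset[OF f e(2)]] by auto
    have F_eq: "F x + (H y - H x) = F y" if y: "y \<in> ball x e" for y
    proof -
      have segment: "closed_segment x y \<subseteq> ball x e"
        using y e(1) by (intro closed_segment_subset) auto
      then have "contour_integral (linepath x y) f = H y - H x"
        using contour_integral_primitive[of "ball x e" H f "linepath x y"] H
        by (simp add: contour_integral_unique)
      moreover have "F y = F x + contour_integral (linepath x y) f"
        unfolding F_def using \<gamma>[OF x] \<gamma>[of y] y e(2) segment
        by (intro contour_integral_eq_add_linepath[OF S(1) f loops]) auto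
      ultimately show ?thesis by simp
    qed
    have "((\<lambda>y. F x + (H y - H x)) has_field_derivative f x) (at x)"
      using H[of x] e(1) by (auto intro!: derivative_eq_intros simp: at_within_open[of x "ball x e"])
    then show ?thesis
      by (rule has_field_derivative_transform_within_open[OF _ open_ball _ F_eq]) (use e(1) in simp_all)
  qed
  then show ?thesis by (rule that)
qed (use that in auto)

lemma holomorphic_log_if_primitive:
  assumes S: "open S" "connected S" and f: "f holomorphic_on S" "\<And>z. z \<in> S \<Longrightarrow> f z \<noteq> 0"
    and F: "\<And>z. z \<in> S \<Longrightarrow> (F has_field_derivative deriv f z / f z) (at z)"
  shows "\<exists>L. L holomorphic_on S \<and> (\<forall>z\<in>S. exp (L z) = f z)"
proof (cases "S = {}")
  case False
  then obtain b where b: "b \<in> S" by blast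
  define L where "L z = F z - F b + Ln (f b)" for z
  have L: "(L has_field_derivative deriv f z / f z) (at z)" if "z \<in> S" for z
    unfolding L_def by (auto intro!: derivative_eq_intros F that)
  define k where "k z = f z * exp (- L z)" for z
  have "(k has_field_derivative 0) (at z)" if "z \<in> S" for z
    unfolding k_def using f(2)[OF that]
    by (auto intro!: derivative_eq_intros L that holomorphic_derivI[OF f(1) S(1)])
  then have "k z = k b" if "z \<in> S" for z
    by (intro has_derivative_zero_unique_connected[OF S _ that b])
      (simp add: has_field_derivative_def lambda_zero)
  moreover have "k b = 1"
    using f(2)[OF b] by (simp add: k_def L_def exp_minus)
  ultimately have "exp (L z) = f z" if "z \<in> S" for z
    using that by (auto simp: k_def exp_minus field_simps)
  moreover have "L holomorphic_on S"
    using L S(1) by (auto simp: holomorphic_on_open)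
  ultimately show ?thesis by blast
qed (auto intro: holomorphic_on_empty)

lemma holomorphic_glue_components:
  assumes \<Omega>: "open \<Omega>"
    and local: "\<And>S. S \<in> components \<Omega> \<Longrightarrow> \<exists>L. L holomorphic_on S \<and> (\<forall>z\<in>S. P z (L z))"
  shows "\<exists>L. L holomorphic_on \<Omega> \<and> (\<forall>z\<in>\<Omega>. P z (L z))"
proof -
  obtain F where F: "\<And>S. S \<in> components \<Omega> \<Longrightarrow> F S holomorphic_on S"
      "\<And>S z. S \<in> components \<Omega> \<Longrightarrow> z \<in> S \<Longrightarrow> P z (F S z)"
    using local by metis
  define L where "L z = F (connected_component_set \<Omega> z) z" for z
  have L: "L z = F S z" if "S \<in> components \<Omega>" "z \<in> S" for S z
    using that unfolding L_def by (metis componentsE connected_component_eq)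
  have "L holomorphic_on (\<Union>S\<in>components \<Omega>. S)"
  proof (rule holomorphic_on_UN_open)
    fix S assume S: "S \<in> components \<Omega>"
    show "L holomorphic_on S"
      using F(1)[OF S] by (rule holomorphic_transform) (simp add: L[OF S])
    show "open S"
      using S \<Omega> open_components by blast
  qed
  then have "L holomorphic_on \<Omega>"
    using Union_components[of \<Omega>] by simp
  moreover have "P z (L z)" if "z \<in> \<Omega>" for z
    using that F(2)[of "connected_component_set \<Omega> z" z] by (simp add: L_def componentsI)
  ultimately show ?thesis by blast
qed

lemma has_contour_integral_pole_difference:
  assumes \<gamma>: "valid_path \<gamma>" "pathfinish \<gamma> = pathstart \<gamma>"
    and C: "connected C" "C \<inter> path_image \<gamma> = {}" "a \<in> C" "\<zeta> \<in> C"
  shows "((\<lambda>z. 1 / (z - a) - 1 / (z - \<zeta>)) has_contour_integral 0) \<gamma>"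
proof -
  have "((\<lambda>z. 1 / (z - w)) has_contour_integral 2 * pi * \<i> * winding_number \<gamma> w) \<gamma>" if "w \<in> C" for w
    using \<gamma> C(2) that by (intro has_contour_integral_winding_number) auto
  from has_contour_integral_diff[OF this[OF C(3)] this[OF C(4)]]
  have "((\<lambda>z. 1 / (z - a) - 1 / (z - \<zeta>)) has_contour_integral
      2 * pi * \<i> * winding_number \<gamma> a - 2 * pi * \<i> * winding_number \<gamma> \<zeta>) \<gamma>" .
  moreover have "winding_number \<gamma> a = winding_number \<gamma> \<zeta>"
    using C \<gamma> by (intro winding_number_eq[of \<gamma> a C \<zeta>] valid_path_imp_path) auto
  ultimately show ?thesis
    by simp
qed

lemma holomorphic_log_quotient:
  assumes \<Omega>: "open \<Omega>" and C: "connected C" "\<zeta> \<in> C" "a \<in> C" "C \<inter> \<Omega> = {}"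
  shows "\<exists>L. L holomorphic_on \<Omega> \<and> (\<forall>z\<in>\<Omega>. exp (L z) = (z - a) / (z - \<zeta>))"
proof (rule holomorphic_glue_components[OF \<Omega>])
  fix S assume "S \<in> components \<Omega>"
  then have S: "open S" "connected S" "C \<inter> S = {}"
    using \<Omega> C(4) open_components in_components_connected in_components_subset by blast+
  have ne: "z \<noteq> \<zeta>" "z \<noteq> a" if "z \<in> S" for z
    using that C S(3) by auto
  define f where "f z = (z - a) / (z - \<zeta>)" for z
  have f: "f holomorphic_on S" "\<And>z. z \<in> S \<Longrightarrow> f z \<noteq> 0"
    unfolding f_def using ne by (auto intro!: holomorphic_intros)
  have log_deriv: "deriv f z / f z = 1 / (z - a) - 1 / (z - \<zeta>)" if z: "z \<in> S" for z
  proof -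
    have "(f has_field_derivative f z * (1 / (z - a) - 1 / (z - \<zeta>))) (at z)"
      unfolding f_def using ne[OF z] by (auto intro!: derivative_eq_intros simp: divide_simps)
    then show ?thesis
      using f(2)[OF z] by (simp add: DERIV_imp_deriv)
  qed
  have loops: "contour_integral \<gamma> (\<lambda>z. deriv f z / f z) = 0"
    if \<gamma>: "valid_path \<gamma>" "path_image \<gamma> \<subseteq> S" "pathfinish \<gamma> = pathstart \<gamma>" for \<gamma>
  proof -
    have "((\<lambda>z. 1 / (z - a) - 1 / (z - \<zeta>)) has_contour_integral 0) \<gamma>"
      using C \<gamma> S(3) by (intro has_contour_integral_pole_difference[where C=C]) auto
    then have "((\<lambda>z. deriv f z / f z) has_contour_integral 0) \<gamma>"
      using \<gamma>(2) log_deriv by (auto elim!: has_contour_integral_eq)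
    then show ?thesis by (rule contour_integral_unique)
  qed
  have "(\<lambda>z. deriv f z / f z) holomorphic_on S"
    using f S(1) by (intro holomorphic_intros)
  from holomorphic_primitive_if_loop_integrals_zero[OF S(1,2) this loops]
  obtain F where "\<And>z. z \<in> S \<Longrightarrow> (F has_field_derivative deriv f z / f z) (at z)"
    by blast
  then have "\<exists>L. L holomorphic_on S \<and> (\<forall>z\<in>S. exp (L z) = f z)"
    using f by (intro holomorphic_log_if_primitive S)
  then show "\<exists>L. L holomorphic_on S \<and> (\<forall>z\<in>S. exp (L z) = (z - a) / (z - \<zeta>))"
    by (simp add: f_def)
qed

lemma quotient_nonpos_Reals_imp_closed_segment:
  fixes z :: complex
  assumes "z \<noteq> \<zeta>" "(z - a) / (z - \<zeta>) \<in> \<real>\<^sub>\<le>\<^sub>0"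
  shows "z \<in> closed_segment \<zeta> a"
proof -
  obtain t where t: "(z - a) / (z - \<zeta>) = - of_real t" "0 \<le> t"
    using assms(2) by (auto simp: nonpos_Reals_def) (metis minus_minus neg_0_le_iff_le of_real_minus)
  have "1 + complex_of_real t = of_real (1 + t)"
    by simp
  then have ne: "1 + complex_of_real t \<noteq> 0"
    using t(2) by (simp only: of_real_eq_0_iff)
  have "z - a = - of_real t * (z - \<zeta>)"
    using t(1) assms(1) by (simp add: field_simps)
  then have "z * (1 + of_real t) = of_real t * \<zeta> + a"
    by (simp add: algebra_simps)
  then have "z = (of_real t * \<zeta> + a) / (1 + of_real t)"
    using ne by (simp add: nonzero_eq_divide_eq)
  also have "\<dots> = (t / (1 + t)) *\<^sub>R \<zeta> + (1 / (1 + t)) *\<^sub>R a"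
    by (simp add: scaleR_conv_of_real add_divide_distrib)
  also have "t / (1 + t) = 1 - 1 / (1 + t)"
    using t(2) by (simp add: field_simps)
  finally have "z = (1 - 1 / (1 + t)) *\<^sub>R \<zeta> + (1 / (1 + t)) *\<^sub>R a" .
  moreover have "0 \<le> 1 / (1 + t)" "1 / (1 + t) \<le> 1"
    using t(2) by auto
  ultimately show ?thesis
    unfolding in_segment by blast
qed

section \<open>Functions blowing up at a boundary point\<close>

definition zero_extension :: "complex set \<Rightarrow> (complex \<Rightarrow> complex) \<Rightarrow> complex \<Rightarrow> complex" where
  "zero_extension \<Omega> g z = (if z \<in> \<Omega> then g z else 0)"

lemma lp_integral_zero_extension:
  assumes "D \<subseteq> \<Omega>"
  shows "lp_integral r D (zero_extension \<Omega> g) = lp_integral r D g"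
  unfolding lp_integral_def using assms
  by (intro nn_integral_cong) (auto simp: zero_extension_def split: split_indicator)

lemma zero_extension_in_OLbelow:
  assumes g: "g holomorphic_on \<Omega>"
    and finite: "\<And>r. 1 \<le> r \<Longrightarrow> ereal r < q \<Longrightarrow> lp_integral r \<Omega> g < top"
  shows "zero_extension \<Omega> g \<in> OLbelow q \<Omega>"
proof -
  have "zero_extension \<Omega> g holomorphic_on \<Omega>"
    using g by (rule holomorphic_transform) (simp add: zero_extension_def)
  then show ?thesis
    using finite by (simp add: OLbelow_def OLp_ereal_iff lp_integral_zero_extension)
      (simp add: zero_extension_def)
qed

lemma filterlim_zero_extension:
  "filterlim (zero_extension \<Omega> g) F (at \<zeta> within \<Omega>) \<longleftrightarrow> filterlim g F (at \<zeta> within \<Omega>)"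
  by (intro filterlim_cong) (auto simp: zero_extension_def eventually_at_filter)

lemma not_bounded_if_filterlim_at_infinity:
  fixes f :: "'a::topological_space \<Rightarrow> 'b::real_normed_vector"
  assumes lim: "filterlim f at_infinity (at a within S)" and E: "E \<subseteq> S" "a islimpt E"
  shows "\<not> bounded (f ` E)"
proof
  assume "bounded (f ` E)"
  then obtain M where M: "\<And>x. x \<in> E \<Longrightarrow> norm (f x) < M"
    by (auto simp: bounded_pos_less)
  have "filterlim (\<lambda>x. norm (f x)) at_top (at a within E)"
    using filterlim_mono[OF lim order_refl at_le[OF E(1)]] by (rule filterlim_at_infinity_imp_norm_at_top)
  then have "\<forall>\<^sub>F x in at a within E. M \<le> norm (f x)"
    by (simp add: filterlim_at_top)
  moreover have "\<forall>\<^sub>F x in at a within E. norm (f x) < M"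
    using M by (simp add: eventually_at_filter)
  ultimately have "\<forall>\<^sub>F x in at a within E. False"
    by eventually_elim simp
  then show False
    using E(2) by (simp add: trivial_limit_within)
qed

lemma filterlim_minus_at_0: "filterlim (\<lambda>z. z - \<zeta>) (at 0) (at \<zeta> within S)"
  for \<zeta> :: "'a::real_normed_vector"
proof -
  have "((\<lambda>z. z - \<zeta>) \<longlongrightarrow> \<zeta> - \<zeta>) (at \<zeta> within S)"
    by (intro tendsto_intros)
  then show ?thesis
    by (simp add: filterlim_at eventually_at_filter)
qed

lemma filterlim_quotient_at_infinity:
  fixes \<zeta> a :: "'a::real_normed_field"
  assumes "a \<noteq> \<zeta>"
  shows "filterlim (\<lambda>z. (z - a) / (z - \<zeta>)) at_infinity (at \<zeta> within S)"
proof (rule filterlim_divide_at_infinity)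
  show "((\<lambda>z. z - a) \<longlongrightarrow> \<zeta> - a) (at \<zeta> within S)"
    by (intro tendsto_intros)
qed (use assms in \<open>simp_all add: filterlim_minus_at_0\<close>)

lemma lp_integral_finite_if_powr_le:
  assumes D: "D \<in> sets borel" "bounded D" and \<beta>: "0 \<le> \<beta>" "\<beta> < 2" and S: "finite S" and C: "0 \<le> C"
    and bound: "\<And>z. z \<in> D \<Longrightarrow> cmod (f z) powr r \<le> C * (\<Sum>c\<in>S. cmod (z - c) powr - \<beta>)"
  shows "lp_integral r D f < top"
proof -
  note [measurable] = D(1)
  have "lp_integral r D f
      \<le> (\<integral>\<^sup>+z. (\<Sum>c\<in>S. ennreal C * (ennreal (cmod (z - c) powr - \<beta>) * indicator D z)) \<partial>lborel)"
    unfolding lp_integral_def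
  proof (intro nn_integral_mono)
    fix z
    show "ennreal (cmod (f z) powr r) * indicator D z
        \<le> (\<Sum>c\<in>S. ennreal C * (ennreal (cmod (z - c) powr - \<beta>) * indicator D z))"
    proof (cases "z \<in> D")
      case True
      have "ennreal (cmod (f z) powr r) \<le> ennreal (\<Sum>c\<in>S. C * cmod (z - c) powr - \<beta>)"
        using bound[OF True] by (simp add: ennreal_leI sum_distrib_left)
      also have "\<dots> = (\<Sum>c\<in>S. ennreal (C * cmod (z - c) powr - \<beta>))"
        using C by (intro sum_ennreal[symmetric]) auto
      finally show ?thesis
        using True C by (simp add: ennreal_mult)
    qed simp
  qed
  also have "\<dots> = (\<Sum>c\<in>S. ennreal C * (\<integral>\<^sup>+z. ennreal (cmod (z - c) powr - \<beta>) * indicator D z \<partial>lborel))"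
    by (subst nn_integral_sum) (auto intro!: sum.cong nn_integral_cmult)
  also have "\<dots> < top"
    using nn_integral_dist_powr_bounded_finite[OF D(2) \<beta>(1)] \<beta>(2) S
    by (simp add: ennreal_mult_eq_top_iff less_top[symmetric])
  finally show ?thesis .
qed

lemma exists_pole_in_OLbelow:
  assumes \<Omega>: "open \<Omega>" "bounded \<Omega>" and \<zeta>: "\<zeta> \<notin> \<Omega>"
  shows "\<exists>h\<in>OLbelow 2 \<Omega>. filterlim h at_infinity (at \<zeta> within \<Omega>)"
proof (intro bexI[of _ "zero_extension \<Omega> (\<lambda>z. inverse (z - \<zeta>))"])
  show "zero_extension \<Omega> (\<lambda>z. inverse (z - \<zeta>)) \<in> OLbelow 2 \<Omega>"
  proof (rule zero_extension_in_OLbelow)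
    show "(\<lambda>z. inverse (z - \<zeta>)) holomorphic_on \<Omega>"
      using \<zeta> by (auto intro!: holomorphic_intros)
    fix r :: real assume "1 \<le> r" "ereal r < 2"
    moreover have "(2::ereal) = ereal 2" by simp
    ultimately have r: "0 \<le> r" "r < 2" by simp_all
    have "cmod (inverse (z - \<zeta>)) powr r \<le> 1 * (\<Sum>c\<in>{\<zeta>}. cmod (z - c) powr - r)" for z
      by (simp add: norm_inverse powr_minus inverse_powr)
    then show "lp_integral r \<Omega> (\<lambda>z. inverse (z - \<zeta>)) < top"
      using r by (intro lp_integral_finite_if_powr_le[OF borel_open[OF \<Omega>(1)] \<Omega>(2), where S="{\<zeta>}" and C=1]) auto
  qed
  show "filterlim (zero_extension \<Omega> (\<lambda>z. inverse (z - \<zeta>))) at_infinity (at \<zeta> within \<Omega>)"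
    unfolding filterlim_zero_extension
    by (rule filterlim_compose[OF filterlim_inverse_at_infinity filterlim_minus_at_0])
qed

text \<open>The logarithm may have unbounded imaginary part, but the modulus of the exponential of its
  real multiples does not depend on it.\<close>
lemma exists_holomorphic_norm_eq_quotient_powr:
  assumes \<Omega>: "open \<Omega>" and C: "connected C" "\<zeta> \<in> C" "a \<in> C" "C \<inter> \<Omega> = {}"
  obtains g where "g holomorphic_on \<Omega>"
    "\<And>z. z \<in> \<Omega> \<Longrightarrow> cmod (g z) = (cmod (z - a) / cmod (z - \<zeta>)) powr \<alpha>"
proof -
  obtain L where L: "L holomorphic_on \<Omega>" "\<And>z. z \<in> \<Omega> \<Longrightarrow> exp (L z) = (z - a) / (z - \<zeta>)"
    using holomorphic_log_quotient[OF \<Omega> C] by blast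
  have "cmod (exp (of_real \<alpha> * L z)) = (cmod (z - a) / cmod (z - \<zeta>)) powr \<alpha>" if "z \<in> \<Omega>" for z
  proof -
    have "cmod (exp (of_real \<alpha> * L z)) = cmod (exp (L z)) powr \<alpha>"
      by (simp add: powr_def)
    then show ?thesis
      by (simp add: L(2)[OF that] norm_divide)
  qed
  moreover have "(\<lambda>z. exp (of_real \<alpha> * L z)) holomorphic_on \<Omega>"
    by (intro holomorphic_intros L)
  ultimately show ?thesis
    using that by blast
qed

lemma filterlim_at_infinity_if_norm_eq_quotient_powr:
  assumes a: "a \<noteq> \<zeta>" and \<alpha>: "0 < \<alpha>"
    and g: "\<And>z. z \<in> S \<Longrightarrow> cmod (g z) = (cmod (z - a) / cmod (z - \<zeta>)) powr \<alpha>"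
  shows "filterlim g at_infinity (at \<zeta> within S)"
proof (rule filterlim_norm_at_top_imp_at_infinity, rule filterlim_at_top_mono)
  show "filterlim (\<lambda>z. exp (\<alpha> * ln (cmod ((z - a) / (z - \<zeta>))))) at_top (at \<zeta> within S)"
    using a \<alpha>
    by (intro filterlim_compose[OF exp_at_top] filterlim_tendsto_pos_mult_at_top[OF tendsto_const]
        filterlim_compose[OF ln_at_top] filterlim_at_infinity_imp_norm_at_top filterlim_quotient_at_infinity)
  have "\<forall>\<^sub>F z in at \<zeta> within S. z \<noteq> a"
    using a by (auto simp: eventually_at intro!: exI[of _ "dist a \<zeta>"])
  then show "\<forall>\<^sub>F z in at \<zeta> within S. exp (\<alpha> * ln (cmod ((z - a) / (z - \<zeta>)))) \<le> cmod (g z)"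
    unfolding eventually_at_filter by eventually_elim (simp add: g powr_def norm_divide)
qed

lemma exists_power_peak_in_OLbelow:
  assumes \<Omega>: "open \<Omega>" "bounded \<Omega>" and C: "connected C" "\<zeta> \<in> C" "a \<in> C" "C \<inter> \<Omega> = {}"
    and a: "a \<noteq> \<zeta>" and q: "1 < q"
  obtains h where "h \<in> OLbelow (ereal q) \<Omega>" "filterlim h at_infinity (at \<zeta> within \<Omega>)"
    "\<And>z. z \<in> \<Omega> \<Longrightarrow> cmod (h z) powr q = (cmod (z - a) / cmod (z - \<zeta>)) powr 2"
proof -
  obtain g where g: "g holomorphic_on \<Omega>"
    "\<And>z. z \<in> \<Omega> \<Longrightarrow> cmod (g z) = (cmod (z - a) / cmod (z - \<zeta>)) powr (2 / q)"
    using exists_holomorphic_norm_eq_quotient_powr[OF \<Omega>(1) C] by metis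
  have "zero_extension \<Omega> g \<in> OLbelow (ereal q) \<Omega>"
  proof (rule zero_extension_in_OLbelow[OF g(1)])
    fix r assume r: "1 \<le> r" "ereal r < ereal q"
    define \<beta> where "\<beta> = 2 / q * r"
    have \<beta>: "0 \<le> \<beta>" "\<beta> < 2"
      using r q by (auto simp: \<beta>_def field_simps)
    obtain R where R: "0 < R" "\<Omega> \<subseteq> ball a R"
      using bounded_subset_ballD[OF \<Omega>(2)] by blast
    have "cmod (g z) powr r \<le> R powr \<beta> * (\<Sum>c\<in>{\<zeta>}. cmod (z - c) powr - \<beta>)" if "z \<in> \<Omega>" for z
    proof -
      have "cmod (z - a) powr \<beta> \<le> R powr \<beta>"
        using R that \<beta> by (intro powr_mono2) (auto simp: dist_norm norm_minus_commute subset_iff)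
      moreover have "cmod (g z) powr r = (cmod (z - a) / cmod (z - \<zeta>)) powr \<beta>"
        by (simp only: g(2)[OF that] powr_powr \<beta>_def)
      ultimately show ?thesis
        by (simp add: powr_divide powr_minus_divide divide_right_mono)
    qed
    then show "lp_integral r \<Omega> g < top"
      using \<beta> by (intro lp_integral_finite_if_powr_le[OF borel_open[OF \<Omega>(1)] \<Omega>(2), where S="{\<zeta>}" and C="R powr \<beta>"]) auto
  qed
  moreover have "filterlim (zero_extension \<Omega> g) at_infinity (at \<zeta> within \<Omega>)"
    unfolding filterlim_zero_extension
    using a q g(2) by (intro filterlim_at_infinity_if_norm_eq_quotient_powr[where \<alpha>="2 / q"]) auto
  moreover have "cmod (zero_extension \<Omega> g z) powr q = (cmod (z - a) / cmod (z - \<zeta>)) powr 2" if "z \<in> \<Omega>" for z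
    using g(2)[OF that] that q by (simp add: zero_extension_def powr_powr)
  ultimately show ?thesis
    by (rule that)
qed

lemma powr_le_powr_mult_exp:
  fixes x r :: real
  assumes "0 \<le> x" "0 < r"
  shows "x powr r \<le> r powr r * exp x"
proof -
  have "x / r \<le> exp (x / r)"
    using exp_ge_add_one_self[of "x / r"] by linarith
  then have "(x / r) powr r \<le> exp (x / r) powr r"
    using assms by (intro powr_mono2) auto
  then show ?thesis
    using assms by (simp add: exp_powr_real powr_divide field_simps)
qed

lemma norm_Ln_powr_le:
  assumes w: "w \<noteq> 0" and r: "0 < r"
  shows "cmod (Ln w) powr r \<le> r powr r * exp pi * (cmod w + inverse (cmod w))"
proof -
  have "\<bar>Im (Ln w)\<bar> \<le> pi"
    using mpi_less_Im_Ln[OF w] Im_Ln_le_pi[OF w] by linarith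
  then have "cmod (Ln w) \<le> pi + \<bar>ln (cmod w)\<bar>"
    using cmod_le[of "Ln w"] w by simp
  moreover have "cmod (Ln w) powr r \<le> r powr r * exp (cmod (Ln w))"
    using r by (intro powr_le_powr_mult_exp) auto
  ultimately have "cmod (Ln w) powr r \<le> r powr r * exp (pi + \<bar>ln (cmod w)\<bar>)"
    by (meson exp_le_cancel_iff mult_left_mono order_trans powr_ge_zero)
  also have "\<dots> = r powr r * exp pi * exp \<bar>ln (cmod w)\<bar>"
    by (simp add: exp_add)
  also have "\<dots> \<le> r powr r * exp pi * (cmod w + inverse (cmod w))"
    using w by (intro mult_left_mono) (auto simp: abs_if exp_minus)
  finally show ?thesis .
qed

lemma lp_integral_Ln_quotient_finite:
  assumes \<Omega>: "open \<Omega>" "bounded \<Omega>" "\<zeta> \<notin> \<Omega>" "a \<notin> \<Omega>" and a: "a \<noteq> \<zeta>" and r: "0 < r"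
  shows "lp_integral r \<Omega> (\<lambda>z. Ln ((z - a) / (z - \<zeta>))) < top"
proof -
  obtain R\<^sub>1 R\<^sub>2 where bounds: "\<forall>z\<in>\<Omega>. dist a z \<le> R\<^sub>1" "\<forall>z\<in>\<Omega>. dist \<zeta> z \<le> R\<^sub>2"
    using \<Omega>(2) bounded_any_center by metis
  define R where "R = max 0 (max R\<^sub>1 R\<^sub>2)"
  have R: "0 \<le> R" "\<And>z. z \<in> \<Omega> \<Longrightarrow> cmod (z - a) \<le> R" "\<And>z. z \<in> \<Omega> \<Longrightarrow> cmod (z - \<zeta>) \<le> R"
    using bounds by (auto simp: R_def dist_norm norm_minus_commute le_max_iff_disj)
  define w where "w z = (z - a) / (z - \<zeta>)" for z
  have "cmod (Ln (w z)) powr r \<le> r powr r * exp pi * R * (\<Sum>c\<in>{\<zeta>, a}. cmod (z - c) powr - 1)"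
    if z: "z \<in> \<Omega>" for z
  proof -
    have "w z \<noteq> 0"
      using z \<Omega>(3,4) by (auto simp: w_def)
    then have "cmod (Ln (w z)) powr r \<le> r powr r * exp pi * (cmod (w z) + inverse (cmod (w z)))"
      using r by (rule norm_Ln_powr_le)
    also have "cmod (w z) + inverse (cmod (w z))
        = cmod (z - a) * cmod (z - \<zeta>) powr - 1 + cmod (z - \<zeta>) * cmod (z - a) powr - 1"
      unfolding w_def norm_divide by (simp add: powr_minus divide_inverse)
    also have "\<dots> \<le> R * cmod (z - \<zeta>) powr - 1 + R * cmod (z - a) powr - 1"
      using R z by (intro add_mono mult_right_mono) auto
    also have "\<dots> = R * (\<Sum>c\<in>{\<zeta>, a}. cmod (z - c) powr - 1)"
      using a by (simp add: distrib_left)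
    finally show ?thesis
      by (simp add: mult_left_mono mult.assoc)
  qed
  then show ?thesis
    unfolding w_def using R(1)
    by (intro lp_integral_finite_if_powr_le[OF borel_open[OF \<Omega>(1)] \<Omega>(2),
          where S="{\<zeta>, a}" and \<beta>=1 and C="r powr r * exp pi * R"]) auto
qed

lemma exists_log_peak_in_OLbelow:
  assumes \<Omega>: "open \<Omega>" "bounded \<Omega>" and segment: "closed_segment \<zeta> a \<inter> \<Omega> = {}" and a: "a \<noteq> \<zeta>"
  shows "\<exists>h\<in>OLbelow \<infinity> \<Omega>. filterlim h at_infinity (at \<zeta> within \<Omega>)"
proof (intro bexI)
  define w where "w z = (z - a) / (z - \<zeta>)" for z
  have "\<zeta> \<notin> \<Omega>" "a \<notin> \<Omega>"
    using segment by auto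
  then have ne: "z \<noteq> \<zeta>" "z \<noteq> a" if "z \<in> \<Omega>" for z
    using that by auto
  have w_slit: "w z \<notin> \<real>\<^sub>\<le>\<^sub>0" if "z \<in> \<Omega>" for z
    using quotient_nonpos_Reals_imp_closed_segment[OF ne(1)[OF that]] segment that by (auto simp: w_def)
  show "zero_extension \<Omega> (\<lambda>z. Ln (w z)) \<in> OLbelow \<infinity> \<Omega>"
  proof (rule zero_extension_in_OLbelow)
    show "(\<lambda>z. Ln (w z)) holomorphic_on \<Omega>"
      using w_slit ne unfolding w_def by (auto intro!: holomorphic_intros)
    show "lp_integral r \<Omega> (\<lambda>z. Ln (w z)) < top" if "1 \<le> r" for r
      unfolding w_def using \<Omega> \<open>\<zeta> \<notin> \<Omega>\<close> \<open>a \<notin> \<Omega>\<close> a that by (intro lp_integral_Ln_quotient_finite) auto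
  qed
  show "filterlim (zero_extension \<Omega> (\<lambda>z. Ln (w z))) at_infinity (at \<zeta> within \<Omega>)"
    unfolding filterlim_zero_extension
  proof (rule filterlim_norm_at_top_imp_at_infinity, rule filterlim_at_top_mono)
    show "filterlim (\<lambda>z. ln (cmod (w z))) at_top (at \<zeta> within \<Omega>)"
      unfolding w_def using a
      by (intro filterlim_compose[OF ln_at_top] filterlim_at_infinity_imp_norm_at_top
          filterlim_quotient_at_infinity)
    have "ln (cmod (w z)) \<le> cmod (Ln (w z))" if "z \<in> \<Omega>" for z
      using ne[OF that] complex_Re_le_cmod[of "Ln (w z)"] by (simp add: w_def)
    then show "\<forall>\<^sub>F z in at \<zeta> within \<Omega>. ln (cmod (w z)) \<le> cmod (Ln (w z))"
      by (simp add: eventually_at_filter)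
  qed
qed

section \<open>Peaks at smooth boundary points\<close>

lemma has_derivative_neg_on_cone:
  fixes \<rho> :: "'a::real_inner \<Rightarrow> real"
  assumes der: "(\<rho> has_derivative (\<lambda>h. g \<bullet> h)) (at \<zeta>)" and \<zeta>: "\<rho> \<zeta> = 0" and g: "g \<noteq> 0"
  obtains r where "0 < r" "\<And>y. y \<in> truncated_cone \<zeta> (- sgn g) r \<Longrightarrow> \<rho> y < 0"
proof -
  have "0 < norm g / 4"
    using g by simp
  then obtain \<delta> where \<delta>: "0 < \<delta>"
    "\<And>y. norm (y - \<zeta>) < \<delta> \<Longrightarrow> norm (\<rho> y - \<rho> \<zeta> - g \<bullet> (y - \<zeta>)) \<le> norm g / 4 * norm (y - \<zeta>)"
    using der[unfolded has_derivative_at_alt] by blast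
  have "\<rho> y < 0" if y: "y \<in> truncated_cone \<zeta> (- sgn g) (\<delta> / 2)" for y
  proof -
    obtain s where s: "0 < s" "s < \<delta> / 2" "y \<in> ball (\<zeta> + s *\<^sub>R (- sgn g)) (s / 4)"
      using y by (auto simp: truncated_cone_def)
    have near: "norm (y - \<zeta>) < 5/4 * s"
      using cone_ball_norm_bounds(2)[OF _ s(3)] g by (simp add: norm_sgn)
    define v where "v = y - (\<zeta> + s *\<^sub>R (- sgn g))"
    have "norm v < s / 4"
      using s(3) by (simp add: v_def dist_norm norm_minus_commute)
    then have "g \<bullet> v \<le> norm g * (s / 4)"
      using norm_cauchy_schwarz[of g v] mult_left_mono[of "norm v" "s / 4" "norm g"] by simp
    moreover have "g \<bullet> (y - \<zeta>) = g \<bullet> v - s * norm g"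
      using g by (simp add: v_def inner_diff_right inner_add_right sgn_div_norm power2_norm_eq_inner[symmetric]
          power2_eq_square)
    moreover have "\<rho> y - g \<bullet> (y - \<zeta>) \<le> norm g / 4 * (5/4 * s)"
    proof -
      have "\<rho> y - g \<bullet> (y - \<zeta>) \<le> \<bar>\<rho> y - g \<bullet> (y - \<zeta>)\<bar>"
        by (rule abs_ge_self)
      also have "\<dots> \<le> norm g / 4 * norm (y - \<zeta>)"
        using \<delta>(2)[of y] near s \<zeta> by simp
      also have "\<dots> \<le> norm g / 4 * (5/4 * s)"
        using near by (intro mult_left_mono) auto
      finally show ?thesis .
    qed
    moreover have "0 < norm g * s"
      using g s by simp
    ultimately show ?thesis
      by (simp add: algebra_simps)
  qed
  then show ?thesis
    using \<delta>(1) by (intro that[of "\<delta> / 2"]) auto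
qed

lemma defining_function_eq_0_on_frontier:
  fixes \<rho> :: "'a::t2_space \<Rightarrow> real"
  assumes \<Omega>: "open \<Omega>" and \<zeta>: "\<zeta> \<in> frontier \<Omega>" and U: "open U" "\<zeta> \<in> U"
    and eq: "\<Omega> \<inter> U = {z \<in> U. \<rho> z < 0}" and cont: "isCont \<rho> \<zeta>"
  shows "\<rho> \<zeta> = 0"
proof (rule antisym)
  have \<Omega>_iff: "z \<in> \<Omega> \<longleftrightarrow> \<rho> z < 0" if "z \<in> U" for z
    using eq that by blast
  have "\<zeta> \<notin> \<Omega>" "\<zeta> \<in> closure \<Omega>"
    using \<zeta> \<Omega> by (auto simp: frontier_def interior_open)
  then show "0 \<le> \<rho> \<zeta>"
    using \<Omega>_iff[OF U(2)] by simp
  show "\<rho> \<zeta> \<le> 0"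
  proof (rule ccontr)
    assume "\<not> ?thesis"
    then have "\<forall>\<^sub>F z in nhds \<zeta>. 0 < \<rho> z"
      using cont order_tendstoD(1) by (fastforce simp: isCont_def tendsto_at_iff_tendsto_nhds)
    moreover have "\<forall>\<^sub>F z in nhds \<zeta>. z \<in> U"
      using U by (simp add: eventually_nhds_in_open)
    ultimately have "\<forall>\<^sub>F z in nhds \<zeta>. z \<notin> \<Omega>"
      by eventually_elim (simp add: \<Omega>_iff)
    then obtain S where "open S" "\<zeta> \<in> S" "\<And>z. z \<in> S \<Longrightarrow> z \<notin> \<Omega>"
      unfolding eventually_nhds by blast
    then show False
      using \<open>\<zeta> \<in> closure \<Omega>\<close> by (auto simp: closure_iff_nhds_not_empty)
  qed
qed

lemma C1_boundary_defining_function: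
  assumes \<Omega>: "open \<Omega>" "C1_boundary \<Omega>" and \<zeta>: "\<zeta> \<in> frontier \<Omega>"
  obtains U and \<rho> :: "complex \<Rightarrow> real" and g where "open U" "\<zeta> \<in> U" "\<And>z. z \<in> U \<Longrightarrow> z \<in> \<Omega> \<longleftrightarrow> \<rho> z < 0"
    "\<rho> \<zeta> = 0" "(\<rho> has_derivative (\<lambda>h. g \<bullet> h)) (at \<zeta>)" "g \<noteq> 0"
proof -
  from bspec[OF \<Omega>(2)[unfolded C1_boundary_def] \<zeta>]
  obtain U \<rho> and grad :: "complex \<Rightarrow> complex" where U: "open U" "\<zeta> \<in> U"
    and \<rho>: "(\<rho> has_derivative (\<lambda>h. grad \<zeta> \<bullet> h)) (at \<zeta>)"
    and g: "grad \<zeta> \<noteq> 0" and eq: "\<Omega> \<inter> U = {z \<in> U. \<rho> z < 0}"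
    by blast
  have "\<rho> \<zeta> = 0"
    using has_derivative_continuous[OF \<rho>]
    by (intro defining_function_eq_0_on_frontier[OF \<Omega>(1) \<zeta> U eq]) simp
  then show ?thesis
    using eq by (intro that[OF U _ _ \<rho> g]) auto
qed

lemma C1_boundary_cones:
  assumes \<Omega>: "open \<Omega>" "C1_boundary \<Omega>" and \<zeta>: "\<zeta> \<in> frontier \<Omega>"
  obtains u r where "cmod u = 1" "0 < r" "truncated_cone \<zeta> u r \<subseteq> \<Omega>" "truncated_cone \<zeta> (- u) r \<inter> \<Omega> = {}"
proof -
  obtain U and \<rho> :: "complex \<Rightarrow> real" and g where U: "open U" "\<zeta> \<in> U"
    and \<Omega>_iff: "\<And>z. z \<in> U \<Longrightarrow> z \<in> \<Omega> \<longleftrightarrow> \<rho> z < 0" and zero: "\<rho> \<zeta> = 0"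
    and \<rho>: "(\<rho> has_derivative (\<lambda>h. g \<bullet> h)) (at \<zeta>)" and g: "g \<noteq> 0"
    by (rule C1_boundary_defining_function[OF assms]) (rule that)
  define u where "u = - sgn g"
  have u: "cmod u = 1" "cmod (- u) = 1"
    using g by (simp_all add: u_def norm_sgn)
  obtain r\<^sub>1 where r\<^sub>1: "0 < r\<^sub>1" "\<And>y. y \<in> truncated_cone \<zeta> u r\<^sub>1 \<Longrightarrow> \<rho> y < 0"
    using has_derivative_neg_on_cone[OF \<rho> zero g] unfolding u_def by blast
  have "((\<lambda>z. - \<rho> z) has_derivative (\<lambda>h. - g \<bullet> h)) (at \<zeta>)"
    using has_derivative_minus[OF \<rho>] by simp
  from has_derivative_neg_on_cone[OF this]
  obtain r\<^sub>2 where r\<^sub>2: "0 < r\<^sub>2" "\<And>y. y \<in> truncated_cone \<zeta> (- u) r\<^sub>2 \<Longrightarrow> - \<rho> y < 0"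
    using zero g by (auto simp: u_def sgn_minus)
  obtain e where e: "0 < e" "ball \<zeta> e \<subseteq> U"
    using U open_contains_ball by blast
  define r where "r = min (e / 2) (min r\<^sub>1 r\<^sub>2)"
  have r: "0 < r" "r \<le> r\<^sub>1" "r \<le> r\<^sub>2" "2 * r \<le> e"
    using e(1) r\<^sub>1(1) r\<^sub>2(1) by (auto simp: r_def min_def)
  have in_U: "truncated_cone \<zeta> v r \<subseteq> U" if "cmod v = 1" for v
    using truncated_cone_subset_ball[OF that, of \<zeta> r] subset_ball[OF r(4)] e(2) by blast
  have "truncated_cone \<zeta> u r \<subseteq> \<Omega>"
    using in_U[OF u(1)] r\<^sub>1(2) truncated_cone_mono[OF r(2)] \<Omega>_iff by blast
  moreover have "z \<notin> \<Omega>" if z: "z \<in> truncated_cone \<zeta> (- u) r" for z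
    using in_U[OF u(2)] r\<^sub>2(2)[of z] truncated_cone_mono[OF r(3)] \<Omega>_iff[of z] z by force
  ultimately show ?thesis
    using that[OF u(1) r(1)] by blast
qed

lemma C1_boundary_outer_segment:
  assumes \<Omega>: "open \<Omega>" "C1_boundary \<Omega>" and \<zeta>: "\<zeta> \<in> frontier \<Omega>"
  obtains a where "a \<noteq> \<zeta>" "closed_segment \<zeta> a \<inter> \<Omega> = {}"
proof -
  obtain u r where u: "cmod u = 1" and r: "0 < r" and outer: "truncated_cone \<zeta> (- u) r \<inter> \<Omega> = {}"
    using C1_boundary_cones[OF assms] by metis
  define a where "a = \<zeta> + (r / 2) *\<^sub>R (- u)"
  have "z \<notin> \<Omega>" if z: "z \<in> closed_segment \<zeta> a" for z
  proof (cases "z = \<zeta>")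
    case True
    then show ?thesis
      using \<zeta> \<Omega>(1) by (simp add: frontier_def interior_open)
  next
    case False
    obtain t where t: "0 \<le> t" "t \<le> 1" "z = (1 - t) *\<^sub>R \<zeta> + t *\<^sub>R a"
      using z by (auto simp: in_segment)
    then have z_eq: "z = \<zeta> + (t * (r / 2)) *\<^sub>R (- u)"
      by (simp add: a_def algebra_simps)
    then have "t \<noteq> 0"
      using False by auto
    then have "0 < t * (r / 2)" "t * (r / 2) \<le> 1 * (r / 2)"
      using t r by (auto intro: mult_right_mono)
    then have "z \<in> truncated_cone \<zeta> (- u) r"
      using r unfolding z_eq truncated_cone_def by (intro UN_I[of "t * (r / 2)"]) auto
    then show ?thesis
      using outer by blast
  qed
  moreover have "a \<noteq> \<zeta>"
    using u r by (auto simp: a_def)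
  ultimately show ?thesis
    using that by blast
qed

lemma lp_integral_infinite_on_cone:
  assumes u: "cmod u = 1" and r: "0 < r" and sub: "truncated_cone \<zeta> u r \<subseteq> D" and C: "0 < C"
    and lower: "\<And>z. z \<in> truncated_cone \<zeta> u r \<Longrightarrow> C * cmod (z - \<zeta>) powr - 2 \<le> cmod (f z) powr q"
  shows "lp_integral q D f = \<infinity>"
proof -
  let ?K = "truncated_cone \<zeta> u r"
  have [measurable]: "?K \<in> sets borel"
    using open_truncated_cone by (rule borel_open)
  have "\<infinity> = ennreal C * (\<integral>\<^sup>+z. ennreal (cmod (z - \<zeta>) powr - 2) * indicator ?K z \<partial>lborel)"
    using nn_integral_dist_powr_truncated_cone_infinite[OF u r, of \<zeta>] C by (simp add: ennreal_mult_top)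
  also have "\<dots> = (\<integral>\<^sup>+z. ennreal C * (ennreal (cmod (z - \<zeta>) powr - 2) * indicator ?K z) \<partial>lborel)"
    by (rule nn_integral_cmult[symmetric]) measurable
  also have "\<dots> \<le> lp_integral q D f"
    unfolding lp_integral_def
  proof (intro nn_integral_mono)
    fix z
    show "ennreal C * (ennreal (cmod (z - \<zeta>) powr - 2) * indicator ?K z)
        \<le> ennreal (cmod (f z) powr q) * indicator D z"
      using lower[of z] sub C
      by (auto simp: ennreal_leI split: split_indicator simp flip: ennreal_mult)
  qed
  finally show ?thesis
    by (simp add: top_unique)
qed

lemma lp_integral_infinite_near_cone_vertex:
  assumes u: "cmod u = 1" and r: "0 < r" and inner: "truncated_cone \<zeta> u r \<subseteq> \<Omega>"
    and C: "0 < C" and e: "0 < e" and \<epsilon>: "0 < \<epsilon>"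
    and lower: "\<And>z. z \<in> ball \<zeta> e \<inter> \<Omega> \<Longrightarrow> C * cmod (z - \<zeta>) powr - 2 \<le> cmod (f z) powr q"
  shows "lp_integral q (ball \<zeta> \<epsilon> \<inter> \<Omega>) f = \<infinity>"
proof -
  define s where "s = min r (min e \<epsilon> / 2)"
  have "truncated_cone \<zeta> u s \<subseteq> ball \<zeta> (2 * s)"
    using u by (rule truncated_cone_subset_ball)
  then have near: "truncated_cone \<zeta> u s \<subseteq> ball \<zeta> e" "truncated_cone \<zeta> u s \<subseteq> ball \<zeta> \<epsilon>"
    by (fastforce simp: s_def)+
  have sub: "truncated_cone \<zeta> u s \<subseteq> \<Omega>"
    using truncated_cone_mono[of s r] inner by (auto simp: s_def)
  show ?thesis
  proof (rule lp_integral_infinite_on_cone[OF u _ _ C])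
    show "0 < s"
      using r e \<epsilon> by (simp add: s_def)
    show "truncated_cone \<zeta> u s \<subseteq> ball \<zeta> \<epsilon> \<inter> \<Omega>"
      using near(2) sub by blast
    show "C * cmod (z - \<zeta>) powr - 2 \<le> cmod (f z) powr q" if "z \<in> truncated_cone \<zeta> u s" for z
      using that near(1) sub by (intro lower) auto
  qed
qed

lemma C1_boundary_nonintegrable_peak:
  assumes \<Omega>: "open \<Omega>" "bounded \<Omega>" "C1_boundary \<Omega>" and \<zeta>: "\<zeta> \<in> frontier \<Omega>" and q: "1 < q"
  shows "\<exists>h\<in>OLbelow (ereal q) \<Omega>. filterlim h at_infinity (at \<zeta> within \<Omega>) \<and>
    (\<forall>\<epsilon>>0. h \<notin> OLp (ereal q) (ball \<zeta> \<epsilon> \<inter> \<Omega>))"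
proof -
  obtain u r where u: "cmod u = 1" and r: "0 < r" and inner: "truncated_cone \<zeta> u r \<subseteq> \<Omega>"
    using C1_boundary_cones[OF \<Omega>(1,3) \<zeta>] by metis
  obtain a where a: "a \<noteq> \<zeta>" "closed_segment \<zeta> a \<inter> \<Omega> = {}"
    using C1_boundary_outer_segment[OF \<Omega>(1,3) \<zeta>] by metis
  obtain h where h: "h \<in> OLbelow (ereal q) \<Omega>" "filterlim h at_infinity (at \<zeta> within \<Omega>)"
    "\<And>z. z \<in> \<Omega> \<Longrightarrow> cmod (h z) powr q = (cmod (z - a) / cmod (z - \<zeta>)) powr 2"
    using exists_power_peak_in_OLbelow[OF \<Omega>(1,2) connected_segment(1) _ _ a(2,1) q]
    by (metis ends_in_segment)
  define e where "e = cmod (a - \<zeta>) / 2"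
  have e: "0 < e"
    using a(1) by (simp add: e_def)
  have "e powr 2 * cmod (z - \<zeta>) powr - 2 \<le> cmod (h z) powr q" if z: "z \<in> ball \<zeta> e \<inter> \<Omega>" for z
  proof -
    have "e \<le> cmod (z - a)"
      using z norm_triangle_ineq[of "a - z" "z - \<zeta>"] by (simp add: e_def dist_norm norm_minus_commute)
    then have "e powr 2 / cmod (z - \<zeta>) powr 2 \<le> cmod (z - a) powr 2 / cmod (z - \<zeta>) powr 2"
      using e by (intro divide_right_mono powr_mono2) auto
    then show ?thesis
      using z by (simp add: h(3) powr_divide powr_minus_divide)
  qed
  then have "lp_integral q (ball \<zeta> \<epsilon> \<inter> \<Omega>) h = \<infinity>" if "0 < \<epsilon>" for \<epsilon>
    using u r inner e that
    by (intro lp_integral_infinite_near_cone_vertex[where C="e powr 2" and e=e]) auto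
  then show ?thesis
    using h(1,2) by (auto simp: OLp_ereal_iff)
qed

lemma C1_boundary_peak:
  assumes \<Omega>: "open \<Omega>" "bounded \<Omega>" "C1_boundary \<Omega>" and \<zeta>: "\<zeta> \<in> frontier \<Omega>" and q: "1 < q"
  shows "\<exists>h\<in>OLbelow q \<Omega>. filterlim h at_infinity (at \<zeta> within \<Omega>) \<and>
    (\<forall>\<epsilon>>0. h \<notin> OLp q (ball \<zeta> \<epsilon> \<inter> \<Omega>))"
proof (cases q)
  case (real r)
  then show ?thesis
    using C1_boundary_nonintegrable_peak[OF \<Omega> \<zeta>] q by simp
next
  case PInf
  obtain a where "a \<noteq> \<zeta>" "closed_segment \<zeta> a \<inter> \<Omega> = {}"
    using C1_boundary_outer_segment[OF \<Omega>(1,3) \<zeta>] by metis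
  then obtain h where h: "h \<in> OLbelow \<infinity> \<Omega>" "filterlim h at_infinity (at \<zeta> within \<Omega>)"
    using exists_log_peak_in_OLbelow[OF \<Omega>(1,2)] by blast
  have "\<zeta> islimpt \<Omega>"
    using \<zeta> \<Omega>(1) by (auto simp: frontier_def interior_open closure_def)
  then have "\<zeta> islimpt ball \<zeta> \<epsilon> \<inter> \<Omega>" if "0 < \<epsilon>" for \<epsilon>
    using islimpt_Int_eventually[of \<zeta> \<Omega> "ball \<zeta> \<epsilon>"] eventually_at_ball[OF that, of \<zeta> UNIV]
    by (simp add: Int_commute)
  then have "\<not> bounded (h ` (ball \<zeta> \<epsilon> \<inter> \<Omega>))" if "0 < \<epsilon>" for \<epsilon>
    using not_bounded_if_filterlim_at_infinity[OF h(2)] that by blast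
  then show ?thesis
    using h by (auto simp: PInf OLp_PInf_iff)
qed (use q in simp)

section \<open>Total unboundedness\<close>

lemma countable_connected_base:
  obtains \<B> :: "'a::{real_normed_vector, second_countable_topology} set set"
  where "countable \<B>" "\<And>B. B \<in> \<B> \<Longrightarrow> open B \<and> connected B"
    "\<And>x U. open U \<Longrightarrow> x \<in> U \<Longrightarrow> \<exists>B\<in>\<B>. x \<in> B \<and> B \<subseteq> U"
proof -
  obtain Q :: "'a set" where Q: "countable Q" "\<And>U. open U \<Longrightarrow> U \<noteq> {} \<Longrightarrow> \<exists>c\<in>Q. c \<in> U"
    using countable_dense_setE by blast
  define \<B> where "\<B> = (\<lambda>(c, n). ball c (inverse (real (Suc n)))) ` (Q \<times> UNIV)"
  have "\<exists>B\<in>\<B>. x \<in> B \<and> B \<subseteq> U" if U: "open U" "x \<in> U" for x U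
  proof -
    obtain e where e: "0 < e" "ball x e \<subseteq> U"
      using U open_contains_ball by blast
    obtain n where n: "inverse (real (Suc n)) < e / 2"
      using reals_Archimedean[of "e / 2"] e(1) by auto
    obtain c where c: "c \<in> Q" "c \<in> ball x (inverse (real (Suc n)))"
      using Q(2)[of "ball x (inverse (real (Suc n)))"] by auto
    have "ball c (inverse (real (Suc n))) \<subseteq> ball x e"
    proof
      fix z assume "z \<in> ball c (inverse (real (Suc n)))"
      then show "z \<in> ball x e"
        using c(2) n dist_triangle[of x z c] by simp
    qed
    then show ?thesis
      using c e(2) by (intro bexI[of _ "ball c (inverse (real (Suc n)))"])
        (auto simp: \<B>_def dist_commute)
  qed
  moreover have "countable \<B>"
    using Q(1) by (auto simp: \<B>_def)
  ultimately show ?thesis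
    by (intro that[of \<B>]) (auto simp: \<B>_def)
qed

lemma component_islimpt_frontier:
  fixes \<Omega> B :: "'a::real_normed_vector set"
  assumes \<Omega>: "open \<Omega>" and B: "open B" "connected B" "B \<inter> frontier \<Omega> \<noteq> {}"
    and E: "E \<in> components (B \<inter> \<Omega>)"
  obtains \<zeta> where "\<zeta> \<in> frontier \<Omega>" "\<zeta> \<in> B" "\<zeta> islimpt E"
proof -
  have E_sub: "E \<subseteq> B \<inter> \<Omega>" and "E \<noteq> {}"
    using E in_components_subset in_components_nonempty by blast+
  have "open E"
    using E \<Omega> B(1) open_components by blast
  have "B \<inter> frontier E \<noteq> {}"
  proof (rule connected_Int_frontier[OF B(2)])
    show "B \<inter> E \<noteq> {}"
      using E_sub \<open>E \<noteq> {}\<close> by blast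
    show "B - E \<noteq> {}"
      using E_sub B(3) \<Omega> by (auto simp: frontier_def interior_open)
  qed
  then obtain \<zeta> where \<zeta>: "\<zeta> \<in> B" "\<zeta> islimpt E" "\<zeta> \<notin> E"
    using \<open>open E\<close> by (auto simp: frontier_def interior_open closure_def)
  have "closedin (top_of_set (B \<inter> \<Omega>)) E"
    using E by (rule closedin_component)
  then have "\<zeta> \<notin> \<Omega>"
    using \<zeta> by (auto simp: closedin_limpt)
  moreover have "\<zeta> \<in> closure \<Omega>"
    using islimpt_subset[OF \<zeta>(2), of \<Omega>] E_sub by (auto simp: closure_def)
  ultimately show ?thesis
    using \<zeta> \<Omega> by (intro that) (auto simp: frontier_def interior_open)
qed

lemma component_contains_component:
  fixes \<Omega> :: "'a::topological_space set"
  assumes E: "E \<in> components (U \<inter> \<Omega>)" and \<zeta>: "\<zeta> islimpt E" and V: "open V" "\<zeta> \<in> V" "V \<subseteq> U"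
  shows "\<exists>F\<in>components (V \<inter> \<Omega>). F \<subseteq> E"
proof -
  obtain y where y: "y \<in> E" "y \<in> V"
    using \<zeta> V by (auto simp: islimpt_def)
  then have "y \<in> V \<inter> \<Omega>"
    using in_components_subset[OF E] by blast
  then obtain F where F: "F \<in> components (V \<inter> \<Omega>)" "y \<in> F"
    using Union_components[of "V \<inter> \<Omega>"] by blast
  have "F \<subseteq> E"
    using F y(1) V(3) in_components_subset[OF F(1)]
    by (intro components_maximal[OF E in_components_connected[OF F(1)]]) auto
  then show ?thesis
    using F(1) by blast
qed

definition boundary_pieces :: "'a::topological_space set set \<Rightarrow> 'a set \<Rightarrow> 'a set set" where
  "boundary_pieces \<B> \<Omega> = (\<Union>B\<in>{B \<in> \<B>. B \<inter> frontier \<Omega> \<noteq> {}}. components (B \<inter> \<Omega>))"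

text \<open>The sets in the base need not be centred on the boundary, so countably many of them suffice.\<close>
lemma totally_unbounded_iff_boundary_pieces:
  assumes \<Omega>: "open \<Omega>" and \<B>: "\<And>B. B \<in> \<B> \<Longrightarrow> open B \<and> connected B"
    and base: "\<And>x U. open U \<Longrightarrow> x \<in> U \<Longrightarrow> \<exists>B\<in>\<B>. x \<in> B \<and> B \<subseteq> U"
  shows "totally_unbounded g \<Omega> \<longleftrightarrow> (\<forall>E\<in>boundary_pieces \<B> \<Omega>. \<not> bounded (g ` E))"
proof -
  have unbounded_mono: "\<not> bounded (g ` E)" if "F \<subseteq> E" "\<not> bounded (g ` F)" for E F
    using that bounded_subset image_mono by metis
  have "totally_unbounded g \<Omega> \<longleftrightarrow>
      (\<forall>w\<in>frontier \<Omega>. \<forall>\<delta>>0. \<forall>E\<in>components (ball w \<delta> \<inter> \<Omega>). \<not> bounded (g ` E))"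
    by (auto simp: totally_unbounded_def components_def)
  also have "\<dots> \<longleftrightarrow> (\<forall>E\<in>boundary_pieces \<B> \<Omega>. \<not> bounded (g ` E))"
  proof (intro iffI ballI allI impI)
    fix E
    assume unbounded: "\<forall>w\<in>frontier \<Omega>. \<forall>\<delta>>0. \<forall>E\<in>components (ball w \<delta> \<inter> \<Omega>). \<not> bounded (g ` E)"
      and "E \<in> boundary_pieces \<B> \<Omega>"
    then obtain B where B: "B \<in> \<B>" "B \<inter> frontier \<Omega> \<noteq> {}" and E: "E \<in> components (B \<inter> \<Omega>)"
      by (auto simp: boundary_pieces_def)
    obtain \<zeta> where \<zeta>: "\<zeta> \<in> frontier \<Omega>" "\<zeta> \<in> B" "\<zeta> islimpt E"
      using component_islimpt_frontier[OF \<Omega> _ _ B(2) E] \<B>[OF B(1)] by metis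
    obtain \<delta> where \<delta>: "0 < \<delta>" "ball \<zeta> \<delta> \<subseteq> B"
      using \<B>[OF B(1)] \<zeta>(2) open_contains_ball by blast
    then obtain F where "F \<in> components (ball \<zeta> \<delta> \<inter> \<Omega>)" "F \<subseteq> E"
      using component_contains_component[OF E \<zeta>(3) open_ball, of \<zeta> \<delta>] by auto
    then show "\<not> bounded (g ` E)"
      using unbounded \<zeta>(1) \<delta>(1) unbounded_mono by blast
  next
    fix w \<delta> E
    assume unbounded: "\<forall>E\<in>boundary_pieces \<B> \<Omega>. \<not> bounded (g ` E)"
      and w: "w \<in> frontier \<Omega>" "0 < (\<delta>::real)" and E: "E \<in> components (ball w \<delta> \<inter> \<Omega>)"
    then have "ball w \<delta> \<inter> frontier \<Omega> \<noteq> {}"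
      using centre_in_ball by blast
    then obtain \<zeta> where \<zeta>: "\<zeta> \<in> frontier \<Omega>" "\<zeta> \<in> ball w \<delta>" "\<zeta> islimpt E"
      using component_islimpt_frontier[OF \<Omega> open_ball connected_ball _ E] by metis
    then obtain B where B: "B \<in> \<B>" "\<zeta> \<in> B" "B \<subseteq> ball w \<delta>"
      using base[OF open_ball] by blast
    then obtain F where F: "F \<in> components (B \<inter> \<Omega>)" "F \<subseteq> E"
      using component_contains_component[OF E \<zeta>(3)] \<B> by blast
    then have "F \<in> boundary_pieces \<B> \<Omega>"
      using B \<zeta>(1) by (auto simp: boundary_pieces_def)
    then show "\<not> bounded (g ` E)"
      using unbounded F(2) unbounded_mono by blast
  qed
  finally show ?thesis .
qed

lemma notin_OLp_balls_iff_base: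
  assumes \<B>: "\<And>B. B \<in> \<B> \<Longrightarrow> open B"
    and base: "\<And>x U. open U \<Longrightarrow> x \<in> U \<Longrightarrow> \<exists>B\<in>\<B>. x \<in> B \<and> B \<subseteq> U"
  shows "(\<forall>\<zeta>\<in>frontier \<Omega>. \<forall>\<epsilon>>0. g \<notin> OLp q (ball \<zeta> \<epsilon> \<inter> \<Omega>)) \<longleftrightarrow>
    (\<forall>B\<in>{B \<in> \<B>. B \<inter> frontier \<Omega> \<noteq> {}}. g \<notin> OLp q (B \<inter> \<Omega>))"
proof -
  have antimono: "g \<notin> OLp q (V \<inter> \<Omega>)" if "U \<subseteq> V" "g \<notin> OLp q (U \<inter> \<Omega>)" for U V
    using OLp_antimono[of "U \<inter> \<Omega>" "V \<inter> \<Omega>" q] that by blast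
  show ?thesis
  proof (intro iffI ballI allI impI)
    fix B assume balls: "\<forall>\<zeta>\<in>frontier \<Omega>. \<forall>\<epsilon>>0. g \<notin> OLp q (ball \<zeta> \<epsilon> \<inter> \<Omega>)"
      and "B \<in> {B \<in> \<B>. B \<inter> frontier \<Omega> \<noteq> {}}"
    then obtain \<zeta> where \<zeta>: "B \<in> \<B>" "\<zeta> \<in> B" "\<zeta> \<in> frontier \<Omega>"
      by blast
    then obtain \<epsilon> where "0 < \<epsilon>" "ball \<zeta> \<epsilon> \<subseteq> B"
      using \<B> open_contains_ball by blast
    then show "g \<notin> OLp q (B \<inter> \<Omega>)"
      using balls \<zeta>(3) antimono by blast
  next
    fix \<zeta> and \<epsilon> :: real
    assume base_sets: "\<forall>B\<in>{B \<in> \<B>. B \<inter> frontier \<Omega> \<noteq> {}}. g \<notin> OLp q (B \<inter> \<Omega>)"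
      and \<zeta>: "\<zeta> \<in> frontier \<Omega>" "0 < \<epsilon>"
    then obtain B where "B \<in> \<B>" "\<zeta> \<in> B" "B \<subseteq> ball \<zeta> \<epsilon>"
      using base[OF open_ball, of \<zeta> \<zeta> \<epsilon>] by auto
    then show "g \<notin> OLp q (ball \<zeta> \<epsilon> \<inter> \<Omega>)"
      using base_sets \<zeta>(1) antimono by blast
  qed
qed

lemma countable_boundary_pieces:
  fixes \<B> :: "'a::euclidean_space set set"
  assumes \<Omega>: "open \<Omega>" and \<B>: "countable \<B>" "\<And>B. B \<in> \<B> \<Longrightarrow> open B"
  shows "countable (boundary_pieces \<B> \<Omega>)"
proof -
  have "countable (components (B \<inter> \<Omega>))" if "B \<in> \<B>" for B
  proof (rule countable_disjoint_open_subsets)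
    show "open E" if "E \<in> components (B \<inter> \<Omega>)" for E
      using that \<Omega> \<B>(2)[OF \<open>B \<in> \<B>\<close>] open_components by blast
    show "pairwise disjnt (components (B \<inter> \<Omega>))"
      using pairwise_disjoint_components[of "B \<inter> \<Omega>"] by (simp add: pairwise_def disjnt_def)
  qed
  then show ?thesis
    unfolding boundary_pieces_def using \<B>(1) by (intro countable_UN) (auto intro: countable_subset)
qed

lemma boundary_pieceE:
  fixes \<Omega> :: "'a::euclidean_space set"
  assumes \<Omega>: "open \<Omega>" and \<B>: "\<And>B. B \<in> \<B> \<Longrightarrow> open B \<and> connected B" and E: "E \<in> boundary_pieces \<B> \<Omega>"
  obtains \<zeta> where "open E" "E \<subseteq> \<Omega>" "\<zeta> \<in> frontier \<Omega>" "\<zeta> islimpt E"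
proof -
  obtain B where B: "B \<in> \<B>" "B \<inter> frontier \<Omega> \<noteq> {}" "E \<in> components (B \<inter> \<Omega>)"
    using E by (auto simp: boundary_pieces_def)
  have "open E" "E \<subseteq> \<Omega>"
    using B \<B>[OF B(1)] \<Omega> open_components in_components_subset by blast+
  moreover obtain \<zeta> where "\<zeta> \<in> frontier \<Omega>" "\<zeta> islimpt E"
    using component_islimpt_frontier[OF \<Omega> _ _ B(2,3)] \<B>[OF B(1)] by metis
  ultimately show ?thesis
    by (rule that)
qed

context OLbelow_space
begin

lemma one_le_q: "1 \<le> q"
proof -
  have "1 < ereal (p 0)"
    using p_gt_1[of 0] by simp
  also have "\<dots> < q"
    by (rule p_less_q)
  finally show ?thesis by simp
qed

lemma dense_gdelta_totally_unbounded_notin_OLp: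
  assumes peak: "\<And>\<zeta>. \<zeta> \<in> frontier \<Omega> \<Longrightarrow> \<exists>h\<in>X. filterlim h at_infinity (at \<zeta> within \<Omega>)"
    and "countable \<D>"
    and \<D>: "\<And>s D. (s, D) \<in> \<D> \<Longrightarrow> 1 \<le> s \<and> open D \<and> D \<subseteq> \<Omega> \<and> (\<exists>h\<in>X. h \<notin> OLp s D)"
  shows "dense_gdelta X d {g \<in> X. totally_unbounded g \<Omega> \<and> (\<forall>(s, D)\<in>\<D>. g \<notin> OLp s D)}"
proof -
  obtain \<B> :: "complex set set" where \<B>: "countable \<B>" "\<And>B. B \<in> \<B> \<Longrightarrow> open B \<and> connected B"
    and base: "\<And>x U. open U \<Longrightarrow> x \<in> U \<Longrightarrow> \<exists>B\<in>\<B>. x \<in> B \<and> B \<subseteq> U"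
    by (rule countable_connected_base) blast
  define \<T> where "\<T> = Pair (\<infinity> :: ereal) ` boundary_pieces \<B> \<Omega>"
  have piece: "open E \<and> E \<subseteq> \<Omega> \<and> (\<exists>h\<in>X. h \<notin> OLp \<infinity> E)" if piece: "E \<in> boundary_pieces \<B> \<Omega>" for E
  proof -
    obtain \<zeta> where E: "open E" "E \<subseteq> \<Omega>" and \<zeta>: "\<zeta> \<in> frontier \<Omega>" "\<zeta> islimpt E"
      using boundary_pieceE[OF open_\<Omega> \<B>(2) piece] by metis
    obtain h where "h \<in> X" "filterlim h at_infinity (at \<zeta> within \<Omega>)"
      using peak[OF \<zeta>(1)] by blast
    then show ?thesis
      using E not_bounded_if_filterlim_at_infinity[OF _ E(2) \<zeta>(2)] by (auto simp: OLp_PInf_iff)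
  qed
  have "totally_unbounded g \<Omega> \<longleftrightarrow> (\<forall>(s, D)\<in>\<T>. g \<notin> OLp s D)" if "g \<in> X" for g
  proof -
    have "totally_unbounded g \<Omega> \<longleftrightarrow> (\<forall>E\<in>boundary_pieces \<B> \<Omega>. \<not> bounded (g ` E))"
      by (rule totally_unbounded_iff_boundary_pieces[OF open_\<Omega> \<B>(2) base])
    also have "\<dots> \<longleftrightarrow> (\<forall>(s, D)\<in>\<T>. g \<notin> OLp s D)"
      using piece holomorphic_on_subset[OF X_holomorphic[OF that]] by (simp add: \<T>_def OLp_PInf_iff)
    finally show ?thesis .
  qed
  then have "{g \<in> X. totally_unbounded g \<Omega> \<and> (\<forall>(s, D)\<in>\<D>. g \<notin> OLp s D)}
      = {g \<in> X. \<forall>(s, D)\<in>\<T> \<union> \<D>. g \<notin> OLp s D}"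
    by blast
  also have "dense_gdelta X d \<dots>"
  proof (rule dense_gdelta_notin_OLp)
    show "countable (\<T> \<union> \<D>)"
      using \<B> \<open>countable \<D>\<close> open_\<Omega> by (simp add: \<T>_def countable_boundary_pieces)
    show "1 \<le> s \<and> open D \<and> D \<subseteq> \<Omega> \<and> (\<exists>h\<in>X. h \<notin> OLp s D)" if "(s, D) \<in> \<T> \<union> \<D>" for s D
      using that \<D> piece by (auto simp: \<T>_def)
  qed
  finally show ?thesis .
qed

lemma dense_gdelta_totally_unbounded:
  assumes "\<And>\<zeta>. \<zeta> \<in> frontier \<Omega> \<Longrightarrow> \<exists>h\<in>X. filterlim h at_infinity (at \<zeta> within \<Omega>)"
  shows "dense_gdelta X d {g \<in> X. totally_unbounded g \<Omega>}"
  using dense_gdelta_totally_unbounded_notin_OLp[OF assms, of "{}"] by simp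

lemma dense_gdelta_totally_unbounded_nonintegrable:
  assumes peak: "\<And>\<zeta>. \<zeta> \<in> frontier \<Omega> \<Longrightarrow> \<exists>h\<in>X. filterlim h at_infinity (at \<zeta> within \<Omega>) \<and>
    (\<forall>\<epsilon>>0. h \<notin> OLp q (ball \<zeta> \<epsilon> \<inter> \<Omega>))"
  shows "dense_gdelta X d {g \<in> X. totally_unbounded g \<Omega> \<and>
    (\<forall>\<zeta>\<in>frontier \<Omega>. \<forall>\<epsilon>>0. g \<notin> OLp q (ball \<zeta> \<epsilon> \<inter> \<Omega>))}"
proof -
  obtain \<B> :: "complex set set" where \<B>: "countable \<B>" "\<And>B. B \<in> \<B> \<Longrightarrow> open B \<and> connected B"
    and base: "\<And>x U. open U \<Longrightarrow> x \<in> U \<Longrightarrow> \<exists>B\<in>\<B>. x \<in> B \<and> B \<subseteq> U"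
    by (rule countable_connected_base) blast
  define \<D> where "\<D> = (\<lambda>B. (q, B \<inter> \<Omega>)) ` {B \<in> \<B>. B \<inter> frontier \<Omega> \<noteq> {}}"
  have "dense_gdelta X d {g \<in> X. totally_unbounded g \<Omega> \<and> (\<forall>(s, D)\<in>\<D>. g \<notin> OLp s D)}"
  proof (rule dense_gdelta_totally_unbounded_notin_OLp)
    show "\<exists>h\<in>X. filterlim h at_infinity (at \<zeta> within \<Omega>)" if "\<zeta> \<in> frontier \<Omega>" for \<zeta>
      using peak[OF that] by blast
    show "countable \<D>"
      using \<B>(1) unfolding \<D>_def by (auto intro: countable_subset)
    fix s D assume "(s, D) \<in> \<D>"
    then obtain B \<zeta> where B: "B \<in> \<B>" "s = q" "D = B \<inter> \<Omega>" and \<zeta>: "\<zeta> \<in> B" "\<zeta> \<in> frontier \<Omega>"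
      by (auto simp: \<D>_def)
    obtain \<epsilon> where \<epsilon>: "0 < \<epsilon>" "ball \<zeta> \<epsilon> \<subseteq> B"
      using \<B>(2)[OF B(1)] \<zeta>(1) open_contains_ball by blast
    obtain h where "h \<in> X" "h \<notin> OLp q (ball \<zeta> \<epsilon> \<inter> \<Omega>)"
      using peak[OF \<zeta>(2)] \<epsilon>(1) by blast
    then have "\<exists>h\<in>X. h \<notin> OLp s D"
      using OLp_antimono[of "ball \<zeta> \<epsilon> \<inter> \<Omega>" "B \<inter> \<Omega>" q] \<epsilon>(2) B(2,3) by blast
    then show "1 \<le> s \<and> open D \<and> D \<subseteq> \<Omega> \<and> (\<exists>h\<in>X. h \<notin> OLp s D)"
      using one_le_q B \<B>(2)[OF B(1)] open_\<Omega> by auto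
  qed
  moreover have "(\<forall>(s, D)\<in>\<D>. g \<notin> OLp s D) \<longleftrightarrow>
      (\<forall>\<zeta>\<in>frontier \<Omega>. \<forall>\<epsilon>>0. g \<notin> OLp q (ball \<zeta> \<epsilon> \<inter> \<Omega>))" for g
  proof -
    have "(\<forall>(s, D)\<in>\<D>. g \<notin> OLp s D) \<longleftrightarrow> (\<forall>B\<in>{B \<in> \<B>. B \<inter> frontier \<Omega> \<noteq> {}}. g \<notin> OLp q (B \<inter> \<Omega>))"
      by (auto simp: \<D>_def)
    also have "\<dots> \<longleftrightarrow> (\<forall>\<zeta>\<in>frontier \<Omega>. \<forall>\<epsilon>>0. g \<notin> OLp q (ball \<zeta> \<epsilon> \<inter> \<Omega>))"
      using \<B>(2) base by (intro notin_OLp_balls_iff_base[symmetric]) auto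
    finally show ?thesis .
  qed
  ultimately show ?thesis
    by simp
qed

end

lemma exists_peak_in_nontrivial_component:
  assumes \<Omega>: "open \<Omega>" "bounded \<Omega>" and q: "1 < q" and \<zeta>: "\<zeta> \<in> frontier \<Omega>"
    and nontrivial: "connected_component_set (- \<Omega>) \<zeta> - {\<zeta>} \<noteq> {}"
  shows "\<exists>h\<in>OLbelow (ereal q) \<Omega>. filterlim h at_infinity (at \<zeta> within \<Omega>)"
proof -
  let ?C = "connected_component_set (- \<Omega>) \<zeta>"
  obtain a where a: "a \<in> ?C" "a \<noteq> \<zeta>"
    using nontrivial by blast
  have "\<zeta> \<in> ?C"
    using \<zeta> \<Omega>(1) by (simp add: frontier_def interior_open)
  moreover have "?C \<inter> \<Omega> = {}"
    using connected_component_subset[of "- \<Omega>" \<zeta>] by blast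
  ultimately show ?thesis
    using exists_power_peak_in_OLbelow[OF \<Omega> connected_connected_component _ a(1) _ a(2) q] by metis
qed

theorem theorem10:
  shows
   "(\<forall>(\<Omega>::complex set) p. open \<Omega> \<and> bounded \<Omega> \<and> admissible_seq 2 p \<longrightarrow>
       (let X = OLbelow 2 \<Omega>; A = {g\<in>X. totally_unbounded g \<Omega>} in
          ms_dense X (OLdist \<Omega> p) A \<and> ms_gdelta X (OLdist \<Omega> p) A))
  \<and> (\<forall>(\<Omega>::complex set) (q::real) p. open \<Omega> \<and> bounded \<Omega> \<and>
       (\<forall>\<zeta>\<in>frontier \<Omega>. connected_component_set (- \<Omega>) \<zeta> - {\<zeta>} \<noteq> {}) \<and>
       1 < q \<and> admissible_seq (ereal q) p \<longrightarrow>
       (let X = OLbelow (ereal q) \<Omega>; A = {g\<in>X. totally_unbounded g \<Omega>} in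
          ms_dense X (OLdist \<Omega> p) A \<and> ms_gdelta X (OLdist \<Omega> p) A))
  \<and> (\<forall>(\<Omega>::complex set) (q::ereal) p. open \<Omega> \<and> bounded \<Omega> \<and> C1_boundary \<Omega> \<and>
       1 < q \<and> admissible_seq q p \<longrightarrow>
       (let X = OLbelow q \<Omega>;
            A = {g\<in>X. totally_unbounded g \<Omega> \<and>
                 (\<forall>\<zeta>\<in>frontier \<Omega>. \<forall>\<epsilon>>0. g \<notin> OLp q (ball \<zeta> \<epsilon> \<inter> \<Omega>))} in
          ms_dense X (OLdist \<Omega> p) A \<and> ms_gdelta X (OLdist \<Omega> p) A))"
proof (intro conjI allI impI; elim conjE; unfold Let_def dense_gdelta_def[symmetric])
  fix \<Omega> :: "complex set" and p
  assume \<Omega>: "open \<Omega>" "bounded \<Omega>" and p: "admissible_seq 2 p"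
  interpret OLbelow_space \<Omega> 2 p
    by standard (fact \<Omega> p)+
  have "\<zeta> \<notin> \<Omega>" if "\<zeta> \<in> frontier \<Omega>" for \<zeta>
    using that \<Omega>(1) by (simp add: frontier_def interior_open)
  then show "dense_gdelta X d {g\<in>X. totally_unbounded g \<Omega>}"
    by (intro dense_gdelta_totally_unbounded exists_pole_in_OLbelow \<Omega>)
next
  fix \<Omega> :: "complex set" and q :: real and p
  assume \<Omega>: "open \<Omega>" "bounded \<Omega>" and q: "1 < q" and p: "admissible_seq (ereal q) p"
    and nontrivial: "\<forall>\<zeta>\<in>frontier \<Omega>. connected_component_set (- \<Omega>) \<zeta> - {\<zeta>} \<noteq> {}"
  interpret OLbelow_space \<Omega> "ereal q" p
    by standard (fact \<Omega> p)+
  show "dense_gdelta X d {g\<in>X. totally_unbounded g \<Omega>}"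
    using nontrivial
    by (intro dense_gdelta_totally_unbounded exists_peak_in_nontrivial_component \<Omega> q) auto
next
  fix \<Omega> :: "complex set" and q :: ereal and p
  assume \<Omega>: "open \<Omega>" "bounded \<Omega>" "C1_boundary \<Omega>" and q: "1 < q" and p: "admissible_seq q p"
  interpret OLbelow_space \<Omega> q p
    by standard (fact \<Omega> p)+
  show "dense_gdelta X d {g\<in>X. totally_unbounded g \<Omega> \<and>
      (\<forall>\<zeta>\<in>frontier \<Omega>. \<forall>\<epsilon>>0. g \<notin> OLp q (ball \<zeta> \<epsilon> \<inter> \<Omega>))}"
    by (intro dense_gdelta_totally_unbounded_nonintegrable C1_boundary_peak \<Omega> q)
qed

end
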